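(* Let $n\ge1$, let $\mathcal{H}$ be a Hilbert space and let $T\in\mathbb{S}_n^B(\mathcal{H})$ be a Beurling tuple. Then $\boldsymbol{D}_T^2\ge 0$ as an operator on $\mathcal{H}^n$.
   Context: Hilbert spaces are complex and separable; $I_n=\{1,\dots,n\}$. For a contraction $X$, $D_X=(I-X^*X)^{1/2}$; $X\in C_{\cdot0}$ means $X^{*m}\to0$ in the strong operator topology. For a commuting $n$-tuple of contractions $T=(T_1,\dots,T_n)$ on $\mathcal{H}$ let $\mathbb{S}_n^{-1}(T,T^* )=\sum_{k\in\{0,1\}^n}(-1)^{|k|}T^kT^{*k}$ with $T^k=T_1^{k_1}\cdots T_n^{k_n}$, $T^{*k}=T_1^{*k_1}\cdots T_n^{*k_n}$, $|k|=\sum_ik_i$. $T$ is a Szegő tuple if $\mathbb{S}_n^{-1}(T,T^* )\ge0$ and all $T_i\in C_{\cdot0}$; it is a Beurling tuple, $T\in\mathbb{S}_n^B(\mathcal{H})$, if moreover $D_{T_i}D_{T_j}=0$ for all $i\ne j$. For $X\in\mathcal{B}(\mathcal{H})$ let $\Delta_X:\mathcal{B}(\mathcal{H})\to\mathcal{B}(\mathcal{H})$, $\Delta_X(A)=XAX^*$. Set $D_{j,T}^2=\prod_{k\in I_n\setminus\{j\}}(I-\Delta_{T_k})(D_{T_j}^2)$ for $j\in I_n$ (for general tuples the superscript $2$ is only notation), and for $i\neq j$, $\delta_{ij}(T)=\prod_{k\in I_n\setminus\{i,j\}}(I-\Delta_{T_k})([T_j,T_i^*])$, where $[A,B]=AB-BA$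 (for $n=2$, $\delta_{ij}(T)=[T_j,T_i^*]$). Here products of maps on $\mathcal{B}(\mathcal{H})$ are compositions (empty product = identity). $\boldsymbol{D}_T^2$ is the operator on $\mathcal{H}^n=\mathcal{H}\oplus\cdots\oplus\mathcal{H}$ given by the $n\times n$ operator matrix whose $(j,j)$ entry is $D_{j,T}^2$ and whose $(i,j)$ entry, $i\ne j$, is $\delta_{ij}(T)$. *)

theory Defs
  imports "HOL-Analysis.Analysis"
begin

section \<open>Complex Hilbert spaces\<close>

class scaleC =
  fixes scaleC :: "complex \<Rightarrow> 'a \<Rightarrow> 'a"  (infixr \<open>*\<^sub>C\<close> 75)

class complex_vector = scaleC + real_vector +
  assumes scaleC_add_right: "c *\<^sub>C (x + y) = c *\<^sub>C x + c *\<^sub>C y"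
    and scaleC_add_left: "(c + d) *\<^sub>C x = c *\<^sub>C x + d *\<^sub>C x"
    and scaleC_scaleC: "c *\<^sub>C d *\<^sub>C x = (c * d) *\<^sub>C x"
    and scaleC_of_real: "complex_of_real r *\<^sub>C x = r *\<^sub>R x"

text \<open>The Hermitian form is linear in its first argument. Its real part is the real inner product
  of the superclass, whose axioms give positive definiteness and the identity
  \<open>norm x = sqrt (Re (cinner x x))\<close>.\<close>

class complex_inner = complex_vector + real_inner +
  fixes cinner :: "'a \<Rightarrow> 'a \<Rightarrow> complex"
  assumes cinner_commute: "cinner x y = cnj (cinner y x)"
    and cinner_add_left: "cinner (x + y) z = cinner x z + cinner y z"
    and cinner_scaleC_left: "cinner (c *\<^sub>C x) y = c * cinner x y"
    and Re_cinner: "Re (cinner x y) = inner x y"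

class chilbert_space = complex_inner + complete_space

text \<open>The Hilbert space direct sum \<open>\<H>\<^sup>n\<close> is the type \<open>'a ^ 'n\<close>.\<close>

instantiation vec :: (complex_vector, finite) complex_vector
begin

definition scaleC_vec_def: "c *\<^sub>C x = (\<chi> i. c *\<^sub>C (x $ i))"

instance
  by standard
    (simp_all add: scaleC_vec_def vec_eq_iff scaleC_add_right scaleC_add_left
      scaleC_scaleC scaleC_of_real)

end

instantiation vec :: (complex_inner, finite) complex_inner
begin

definition cinner_vec_def: "cinner x y = (\<Sum>i\<in>UNIV. cinner (x $ i) (y $ i))"

instance
proof
  fix x y z :: "'a ^ 'b" and c :: complex
  show "cinner x y = cnj (cinner y x)"
    unfolding cinner_vec_def cnj_sum by (intro sum.cong refl cinner_commute)
  show "cinner (x + y) z = cinner x z + cinner y z"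
    by (simp add: cinner_vec_def cinner_add_left sum.distrib)
  show "cinner (c *\<^sub>C x) y = c * cinner x y"
    by (simp add: cinner_vec_def scaleC_vec_def cinner_scaleC_left sum_distrib_left)
  show "Re (cinner x y) = inner x y"
    by (simp add: cinner_vec_def inner_vec_def Re_cinner)
qed

end

instance vec :: (chilbert_space, finite) chilbert_space ..


section \<open>Bounded operators\<close>

definition bounded_clinear :: "('a::complex_inner \<Rightarrow> 'a) \<Rightarrow> bool" where
  "bounded_clinear f \<longleftrightarrow> bounded_linear f \<and> (\<forall>c x. f (c *\<^sub>C x) = c *\<^sub>C f x)"

typedef (overloaded) 'a bop = "{f :: 'a::complex_inner \<Rightarrow> 'a. bounded_clinear f}"
  morphisms bop_apply Bop
proof
  show "id \<in> {f :: 'a \<Rightarrow> 'a. bounded_clinear f}"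
    by (simp add: bounded_clinear_def id_def bounded_linear_ident)
qed

setup_lifting type_definition_bop

lemma scaleC_zero_right: "c *\<^sub>C (0 :: 'a::complex_vector) = 0"
  using scaleC_add_right[of c 0 "0 :: 'a"] by simp

lemma scaleC_minus_right: "c *\<^sub>C (- x) = - (c *\<^sub>C (x :: 'a::complex_vector))"
  using scaleC_add_right[of c x "- x"] by (simp add: scaleC_zero_right eq_neg_iff_add_eq_0 add.commute)

lemma scaleC_diff_right: "c *\<^sub>C (x - y) = c *\<^sub>C x - c *\<^sub>C (y :: 'a::complex_vector)"
  using scaleC_add_right[of c x "- y"] by (simp add: scaleC_minus_right)

lemma scaleC_scaleR_commute: "c *\<^sub>C r *\<^sub>R x = r *\<^sub>R c *\<^sub>C (x :: 'a::complex_vector)"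
  by (metis scaleC_of_real scaleC_scaleC mult.commute)

lemma scaleC_sum_right: "c *\<^sub>C (\<Sum>i\<in>I. f i) = (\<Sum>i\<in>I. c *\<^sub>C (f i :: 'a::complex_vector))"
  by (induction I rule: infinite_finite_induct) (simp_all add: scaleC_zero_right scaleC_add_right)

text \<open>The class \<open>ring_1\<close> is out of reach because \<open>0 = 1\<close> on the zero space.\<close>

instantiation bop :: (complex_inner) "{ring, monoid_mult, real_vector}"
begin

lift_definition zero_bop :: "'a bop" is "\<lambda>x. 0"
  by (simp add: bounded_clinear_def scaleC_zero_right)

lift_definition one_bop :: "'a bop" is "\<lambda>x. x"
  by (simp add: bounded_clinear_def bounded_linear_ident)

lift_definition plus_bop :: "'a bop \<Rightarrow> 'a bop \<Rightarrow> 'a bop" is "\<lambda>f g x. f x + g x"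
  by (simp add: bounded_clinear_def bounded_linear_add scaleC_add_right)

lift_definition uminus_bop :: "'a bop \<Rightarrow> 'a bop" is "\<lambda>f x. - f x"
  by (simp add: bounded_clinear_def bounded_linear_minus scaleC_minus_right)

lift_definition minus_bop :: "'a bop \<Rightarrow> 'a bop \<Rightarrow> 'a bop" is "\<lambda>f g x. f x - g x"
  by (simp add: bounded_clinear_def bounded_linear_sub scaleC_diff_right)

lift_definition times_bop :: "'a bop \<Rightarrow> 'a bop \<Rightarrow> 'a bop" is "\<lambda>f g x. f (g x)"
  by (simp add: bounded_clinear_def bounded_linear_compose)

lift_definition scaleR_bop :: "real \<Rightarrow> 'a bop \<Rightarrow> 'a bop" is "\<lambda>r f x. r *\<^sub>R f x"
  by (simp add: bounded_clinear_def bounded_linear_const_scaleR scaleC_scaleR_commute)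

instance
  by standard
    (transfer, force simp: fun_eq_iff bounded_clinear_def linear_simps algebra_simps)+

end

definition is_adjoint :: "'a::complex_inner bop \<Rightarrow> 'a bop \<Rightarrow> bool" where
  "is_adjoint A B \<longleftrightarrow> (\<forall>x y. cinner (bop_apply A x) y = cinner x (bop_apply B y))"

definition adj :: "'a::chilbert_space bop \<Rightarrow> 'a bop" where
  "adj A = (THE B. is_adjoint A B)"

definition positive_op :: "'a::complex_inner bop \<Rightarrow> bool" where
  "positive_op A \<longleftrightarrow> (\<forall>x. cinner (bop_apply A x) x \<in> \<real>\<^sub>\<ge>\<^sub>0)"

text \<open>Only meaningful for positive operators, where the positive square root exists uniquely.\<close>

definition op_sqrt :: "'a::chilbert_space bop \<Rightarrow> 'a bop" where
  "op_sqrt A = (THE S. positive_op S \<and> S * S = A)"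

definition contraction :: "'a::complex_inner bop \<Rightarrow> bool" where
  "contraction X \<longleftrightarrow> (\<forall>x. norm (bop_apply X x) \<le> norm x)"

definition defect :: "'a::chilbert_space bop \<Rightarrow> 'a bop" where
  "defect X = op_sqrt (1 - adj X * X)"

definition C_dot_zero :: "'a::chilbert_space bop \<Rightarrow> bool" where
  "C_dot_zero X \<longleftrightarrow> (\<forall>x. (\<lambda>m. bop_apply (adj X ^ m) x) \<longlonglongrightarrow> 0)"

definition commutator :: "'a::complex_inner bop \<Rightarrow> 'a bop \<Rightarrow> 'a bop" where
  "commutator A B = A * B - B * A"


section \<open>Szego and Beurling tuples\<close>

text \<open>An \<open>n\<close>-tuple is a family over a finite linearly ordered index type \<open>'n\<close>, which plays the role
  of \<open>{1, \<dots>, n}\<close> with \<open>n = CARD('n)\<close>; the order fixes the order of the factors in products.\<close>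

definition multi_power :: "('n::{finite,linorder} \<Rightarrow> 'a::complex_inner bop) \<Rightarrow> ('n \<Rightarrow> nat) \<Rightarrow> 'a bop"
  where "multi_power T k = (\<Prod>i\<leftarrow>sorted_list_of_set UNIV. T i ^ k i)"

definition szego_inverse :: "('n::{finite,linorder} \<Rightarrow> 'a::chilbert_space bop) \<Rightarrow> 'a bop" where
  "szego_inverse T =
    (\<Sum>k | \<forall>i. k i \<in> {0, 1}.
      (- 1) ^ (\<Sum>i\<in>UNIV. k i) *\<^sub>R (multi_power T k * multi_power (\<lambda>i. adj (T i)) k))"

definition szego_tuple :: "('n::{finite,linorder} \<Rightarrow> 'a::chilbert_space bop) \<Rightarrow> bool" where
  "szego_tuple T \<longleftrightarrow>
    (\<forall>i. contraction (T i)) \<and> (\<forall>i j. T i * T j = T j * T i) \<and>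
    positive_op (szego_inverse T) \<and> (\<forall>i. C_dot_zero (T i))"

definition beurling_tuple :: "('n::{finite,linorder} \<Rightarrow> 'a::chilbert_space bop) \<Rightarrow> bool" where
  "beurling_tuple T \<longleftrightarrow>
    szego_tuple T \<and> (\<forall>i j. i \<noteq> j \<longrightarrow> defect (T i) * defect (T j) = 0)"


section \<open>The operator matrix\<close>

definition Delta :: "'a::chilbert_space bop \<Rightarrow> 'a bop \<Rightarrow> 'a bop" where
  "Delta X A = X * A * adj X"

text \<open>The composition of the maps \<open>I - \<Delta>\<^bsub>T k\<^esub>\<close> over \<open>k \<in> K\<close>.\<close>

definition Delta_prod ::
  "('n::{finite,linorder} \<Rightarrow> 'a::chilbert_space bop) \<Rightarrow> 'n set \<Rightarrow> 'a bop \<Rightarrow> 'a bop" where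
  "Delta_prod T K = foldr (\<lambda>k F. (\<lambda>A. A - Delta (T k) A) \<circ> F) (sorted_list_of_set K) id"

definition defect_sq :: "('n::{finite,linorder} \<Rightarrow> 'a::chilbert_space bop) \<Rightarrow> 'n \<Rightarrow> 'a bop" where
  "defect_sq T j = Delta_prod T (UNIV - {j}) (defect (T j) ^ 2)"

definition delta_entry ::
  "('n::{finite,linorder} \<Rightarrow> 'a::chilbert_space bop) \<Rightarrow> 'n \<Rightarrow> 'n \<Rightarrow> 'a bop" where
  "delta_entry T i j = Delta_prod T (UNIV - {i, j}) (commutator (T j) (adj (T i)))"

lemma bounded_linear_vec_lambda:
  fixes g :: "'n::finite \<Rightarrow> 'a::real_normed_vector \<Rightarrow> 'b::real_normed_vector"
  assumes g: "\<And>i. bounded_linear (g i)"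
  shows "bounded_linear (\<lambda>x. \<chi> i. g i x)"
proof (rule bounded_linear_intro)
  show "(\<chi> i. g i (x + y)) = (\<chi> i. g i x) + (\<chi> i. g i y)" for x y
    using g by (simp add: vec_eq_iff linear_simps)
  show "(\<chi> i. g i (r *\<^sub>R x)) = r *\<^sub>R (\<chi> i. g i x)" for r x
    using g by (simp add: vec_eq_iff linear_simps)
  show "norm (\<chi> i. g i x) \<le> norm x * (\<Sum>i\<in>UNIV. onorm (g i))" for x
  proof -
    have "norm (\<chi> i. g i x) \<le> (\<Sum>i\<in>UNIV. norm (g i x))"
      unfolding norm_vec_def by (rule order_trans[OF L2_set_le_sum]) simp_all
    also have "\<dots> \<le> (\<Sum>i\<in>UNIV. onorm (g i) * norm x)"
      by (intro sum_mono onorm g)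
    finally show ?thesis
      by (simp add: sum_distrib_left mult.commute)
  qed
qed

lift_definition op_matrix :: "('n::finite \<Rightarrow> 'n \<Rightarrow> 'a::complex_inner bop) \<Rightarrow> ('a ^ 'n) bop"
  is "\<lambda>M x. \<chi> i. \<Sum>j\<in>UNIV. M i j (x $ j)"
proof -
  fix M :: "'n \<Rightarrow> 'n \<Rightarrow> 'a \<Rightarrow> 'a"
  assume M: "\<And>i j. bounded_clinear (M i j)"
  have "bounded_linear (\<lambda>x :: 'a ^ 'n. \<Sum>j\<in>UNIV. M i j (x $ j))" for i
    using M by (intro bounded_linear_sum)
      (auto simp: bounded_clinear_def intro: bounded_linear_compose bounded_linear_vec_nth)
  then have "bounded_linear (\<lambda>x :: 'a ^ 'n. \<chi> i. \<Sum>j\<in>UNIV. M i j (x $ j))"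
    by (rule bounded_linear_vec_lambda)
  then show "bounded_clinear (\<lambda>x :: 'a ^ 'n. \<chi> i. \<Sum>j\<in>UNIV. M i j (x $ j))"
    using M by (simp add: bounded_clinear_def scaleC_vec_def vec_eq_iff scaleC_sum_right)
qed

definition defect_matrix :: "('n::{finite,linorder} \<Rightarrow> 'a::chilbert_space bop) \<Rightarrow> ('a, 'n) vec bop" where
  "defect_matrix T = op_matrix (\<lambda>i j. if i = j then defect_sq T j else delta_entry T i j)"

end

theory Submission
  imports Defs
begin

text \<open>The proof exhibits the operator matrix as a sum of positive matrices. Write \<open>S L\<close> for
  \<open>\<Prod>\<^sub>k\<^sub>\<in>\<^sub>L (I - \<Delta>\<^bsub>T k\<^esub>)(I)\<close>. The heart of the matter is the identity (\<open>D_eq_sum\<close>)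
  for the entries \<open>D i j\<close> of the matrix,
  \<open>D i j = \<Sum>\<^sub>M (W i M)\<^sup>* S (- M) (W j M)\<close>,
  where \<open>M\<close> runs over all sets of indices and the \<open>W j M\<close> are explicit polynomials in the \<open>T i\<close> and
  their adjoints. It reduces the theorem to \<open>S L \<ge> 0\<close> for all \<open>L\<close>, which follows from
  \<open>S UNIV \<ge> 0\<close> and the \<open>C\<^sub>\<cdot>\<^sub>0\<close> condition (\<open>positive_S\<close>).

  The identity comes from dilation theory, although the proof uses no dilation. A Szego tuple has a
  doubly commuting isometric dilation \<open>V\<close> on some space containing \<open>\<H>\<close>, with
  \<open>V\<^sub>i\<^sup>*\<close> extending \<open>T\<^sub>i\<^sup>*\<close>. Let \<open>R\<^sub>i\<close> be the
  restriction of \<open>V\<^sub>i\<close> to the complement of \<open>\<H>\<close>, and let \<open>\<beta>\<^sub>i\<close> map \<open>h\<close> to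
  \<open>V\<^sub>i h - T\<^sub>i h\<close>, which is the part of \<open>V\<^sub>i h\<close> in that complement. Then
  \<open>\<beta>\<^sub>i\<^sup>* \<beta>\<^sub>j\<close> is \<open>[T\<^sub>j, T\<^sub>i\<^sup>*]\<close> for \<open>i \<noteq> j\<close> and
  \<open>I - T\<^sub>i\<^sup>* T\<^sub>i\<close> for \<open>i = j\<close>. The Beurling condition says that
  \<open>\<beta>\<^sub>i \<beta>\<^sub>j\<^sup>* = 0\<close> for \<open>i \<noteq> j\<close>, that is, that the \<open>R\<^sub>i\<close> commute doubly. So
  \<open>E = \<Prod>\<^sub>k (I - R\<^sub>k R\<^sub>k\<^sup>*)\<close> is a projection, and the entries are
  \<open>D i j = \<beta>\<^sub>i\<^sup>* E \<beta>\<^sub>j = (E \<beta>\<^sub>i)\<^sup>* (E \<beta>\<^sub>j)\<close>.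

  The vectors that occur lie in the sum of the spaces \<open>V\<^sub>K \<H>\<close> over sets \<open>K\<close> of indices, where
  \<open>V\<^sub>K\<close> is the product of the \<open>V\<^sub>k\<close>, \<open>k \<in> K\<close>. In this sum a vector is described by coordinates in \<open>\<H>\<close>, one
  for each set \<open>M\<close>, and the inner product becomes the sum of the forms given by \<open>S (- M)\<close>. The
  coordinate of \<open>h \<in> \<H>\<close> at \<open>M\<close> is \<open>T\<^sub>M\<^sup>* h\<close>, and that of \<open>V\<^sub>i h\<close> is
  \<open>T\<^sub>N\<^sup>* h\<close> with \<open>N = M - {i}\<close> if \<open>i \<in> M\<close>, and \<open>0\<close> otherwise. So \<open>B i M\<close> below is the coordinate of
  \<open>\<beta>\<^sub>i\<close>, and \<open>W i M\<close> is that of \<open>E \<beta>\<^sub>i\<close>.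

  In coordinates, the orthogonality of \<open>V\<^sub>K \<beta>\<^sub>i h\<close> to \<open>\<H>\<close> is a resolution of the
  identity (\<open>sum_P_S_Q\<close>, \<open>sum_P_S_B\<close>). What remains is that
  \<open>V\<^sub>k\<^sup>* E \<beta>\<^sub>j = D k j\<close>, which is lemma \<open>S_W\<close>. There the Beurling condition
  enters through the subspaces \<open>ker (I - T\<^sub>k\<^sup>* T\<^sub>k)\<close>: they contain the ranges of the
  \<open>[T\<^sub>j, T\<^sub>l\<^sup>*]\<close> and \<open>I - T\<^sub>l\<^sup>* T\<^sub>l\<close> with \<open>l \<noteq> k\<close>, and on them \<open>T\<^sub>k\<close> is
  isometric and commutes with every \<open>T\<^sub>j\<^sup>*\<close>, \<open>j \<noteq> k\<close> (\<open>isometric_on_comm\<close>).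

  Adjoints and positive square roots of operators are obtained beforehand, from the Riesz
  representation theorem and by iteration.\<close>

instance chilbert_space \<subseteq> banach ..

section \<open>Adjoints\<close>

lemma cinner_add_right: "cinner x (y + z) = cinner x y + cinner (x::'a::complex_inner) z"
  by (metis cinner_add_left cinner_commute complex_cnj_add)

lemma cinner_scaleC_right: "cinner x (c *\<^sub>C y) = cnj c * cinner (x::'a::complex_inner) y"
  by (metis cinner_commute cinner_scaleC_left complex_cnj_mult)

lemma cinner_sum_left: "cinner (\<Sum>i\<in>I. f i) y = (\<Sum>i\<in>I. cinner (f i :: 'a::complex_inner) y)"
proof (induction I rule: infinite_finite_induct)
  have "cinner 0 y = 0"
    using cinner_add_left[of 0 0 y] by simp
  then show "\<And>A. infinite A \<Longrightarrow> cinner (\<Sum>i\<in>A. f i) y = (\<Sum>i\<in>A. cinner (f i) y)"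
    "cinner (\<Sum>i\<in>{}. f i) y = (\<Sum>i\<in>{}. cinner (f i) y)" by simp_all
qed (simp add: cinner_add_left)

lemma cinner_sum_right: "cinner x (\<Sum>i\<in>I. f i) = (\<Sum>i\<in>I. cinner x (f i :: 'a::complex_inner))"
proof -
  have "cinner x (\<Sum>i\<in>I. f i) = (\<Sum>i\<in>I. cnj (cinner (f i) x))"
    by (subst cinner_commute) (simp add: cinner_sum_left)
  then show ?thesis
    by (simp add: cinner_commute[of x])
qed

lemma Im_cinner: "Im (cinner x y) = inner x (\<i> *\<^sub>C (y::'a::complex_inner))"
  by (simp add: Re_cinner[symmetric] cinner_scaleC_right)

lemma inner_scaleC: "inner (c *\<^sub>C x) y = inner x (cnj c *\<^sub>C (y::'a::complex_inner))"
  by (simp add: Re_cinner[symmetric] cinner_scaleC_left cinner_scaleC_right)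

lemma bop_eqI: "(\<And>x. bop_apply A x = bop_apply B x) \<Longrightarrow> A = B"
  using bop_apply_inject by blast

lemma bop_linear: "bounded_linear (bop_apply A)"
  using bop_apply[of A] by (simp add: bounded_clinear_def)

lemma bop_scaleC: "bop_apply A (c *\<^sub>C x) = c *\<^sub>C bop_apply A x"
  using bop_apply[of A] by (simp add: bounded_clinear_def)

lemmas bop_linear_simps = bop_linear[THEN bounded_linear.linear, THEN linear_add]
  bop_linear[THEN bounded_linear.linear, THEN linear_diff]
  bop_linear[THEN bounded_linear.linear, THEN linear_0]
  bop_linear[THEN bounded_linear.linear, THEN linear_sum]
  bop_linear[THEN bounded_linear.linear, THEN linear_scale]

lemma bop_simps [simp]:
  "bop_apply 0 x = 0" "bop_apply 1 x = x"
  "bop_apply (A + B) x = bop_apply A x + bop_apply B x"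
  "bop_apply (A - B) x = bop_apply A x - bop_apply B x"
  "bop_apply (- A) x = - bop_apply A x"
  "bop_apply (A * B) x = bop_apply A (bop_apply B x)"
  "bop_apply (r *\<^sub>R A) x = r *\<^sub>R bop_apply A x"
  by (transfer, simp)+

lemma bop_sum: "bop_apply (\<Sum>i\<in>I. f i) x = (\<Sum>i\<in>I. bop_apply (f i) x)"
  by (induction I rule: infinite_finite_induct) simp_all

instance bop :: (complex_inner) real_algebra
  by standard (auto intro!: bop_eqI simp: bop_linear_simps)

text \<open>The representing vector minimizes \<open>\<parallel>x\<parallel>\<^sup>2 - 2 f x\<close>.\<close>

theorem riesz_representation:
  fixes f :: "'a::{real_inner,complete_space} \<Rightarrow> real"
  assumes f: "bounded_linear f"
  obtains y where "\<And>x. f x = inner x y"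
proof -
  interpret f: bounded_linear f by fact
  obtain K where K: "\<And>x. \<bar>f x\<bar> \<le> norm x * K"
    using f.bounded by auto
  define q where "q x = norm x ^ 2 - 2 * f x" for x
  have q_alt: "q x = inner x x - 2 * f x" for x
    by (simp add: q_def power2_norm_eq_inner)
  have "- (K ^ 2) \<le> q x" for x
  proof -
    have "0 \<le> (norm x - K) ^ 2" by simp
    then show ?thesis
      using K[of x] by (simp add: q_def power2_eq_square algebra_simps)
  qed
  then have bdd: "bdd_below (range q)" by (auto intro!: bdd_belowI)
  define d where "d = Inf (range q)"
  have d: "d \<le> q x" for x
    unfolding d_def using bdd by (intro cInf_lower) auto
  have "\<exists>x. q x < d + 1 / Suc n" for n
  proof -
    have "Inf (range q) < d + 1 / Suc n" by (simp add: d_def)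
    then show ?thesis
      using bdd by (subst (asm) cInf_less_iff) auto
  qed
  then obtain X where X: "\<And>n. q (X n) < d + 1 / Suc n" by metis
  \<comment> \<open>By the parallelogram law, every minimizing sequence is Cauchy.\<close>
  have par: "norm (x - y) ^ 2 = 2 * q x + 2 * q y - 4 * q ((1/2) *\<^sub>R (x + y))" for x y
    by (simp add: q_alt power2_norm_eq_inner f.add f.scaleR f.diff inner_simps inner_commute field_simps)
  have "Cauchy X"
  proof (rule metric_CauchyI)
    fix e :: real assume e: "e > 0"
    obtain N where N: "1 / Suc N < e ^ 2 / 4"
      using reals_Archimedean[of "e ^ 2 / 4"] e by (auto simp: inverse_eq_divide)
    show "\<exists>M. \<forall>m\<ge>M. \<forall>n\<ge>M. dist (X m) (X n) < e"
    proof (intro exI allI impI)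
      fix m n assume "m \<ge> N" "n \<ge> N"
      then have "1 / Suc m \<le> 1 / Suc N" "1 / Suc n \<le> 1 / Suc N"
        by (simp_all add: frac_le)
      then have "norm (X m - X n) ^ 2 < e ^ 2"
        using par[of "X m" "X n"] X[of m] X[of n] d[of "(1/2) *\<^sub>R (X m + X n)"] N by linarith
      then show "dist (X m) (X n) < e"
        using e by (simp add: dist_norm power_less_imp_less_base)
    qed
  qed
  then obtain y where y: "X \<longlonglongrightarrow> y"
    using Cauchy_convergent convergent_def by blast
  have "(\<lambda>n. q (X n)) \<longlonglongrightarrow> q y"
    unfolding q_def by (intro tendsto_intros f.tendsto y)
  moreover have "(\<lambda>n. d + 1 / Suc n) \<longlonglongrightarrow> d"
    using LIMSEQ_inverse_real_of_nat_add[of d] by (simp add: inverse_eq_divide)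
  ultimately have "q y \<le> d"
    using X by (meson LIMSEQ_le less_imp_le)
  then have min: "q y \<le> q x" for x using d[of x] by linarith
  have "f x = inner x y" for x
  proof (rule ccontr)
    assume "f x \<noteq> inner x y"
    define a where "a = f x - inner x y"
    have a: "a \<noteq> 0" using \<open>f x \<noteq> inner x y\<close> by (simp add: a_def)
    define t where "t = a / (1 + inner x x)"
    have pos: "1 + inner x x > 0" by (simp add: add_pos_nonneg)
    have "q (y + t *\<^sub>R x) = q y - 2 * t * a + t ^ 2 * inner x x"
      by (simp add: q_alt f.add f.scaleR inner_simps inner_commute a_def power2_eq_square algebra_simps)
    then have "2 * t * a \<le> t ^ 2 * inner x x"
      using min[of "y + t *\<^sub>R x"] by linarith
    also have "\<dots> \<le> t ^ 2 * (1 + inner x x)"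
      by (intro mult_left_mono) auto
    also have "\<dots> = t * a"
      using pos by (simp add: t_def power2_eq_square)
    finally have "t * a \<le> 0" by (simp add: mult.commute)
    moreover have "t * a > 0"
      using a pos by (auto simp: t_def zero_less_divide_iff power2_eq_square[symmetric])
    ultimately show False by simp
  qed
  then show ?thesis by (rule that)
qed

text \<open>Operators being complex linear, the real inner product suffices to describe adjoints.\<close>

lemma is_adjoint_iff: "is_adjoint A B \<longleftrightarrow> (\<forall>x y. inner (bop_apply A x) y = inner x (bop_apply B y))"
proof
  assume "is_adjoint A B"
  then show "\<forall>x y. inner (bop_apply A x) y = inner x (bop_apply B y)"
    by (metis is_adjoint_def Re_cinner)
next
  assume *: "\<forall>x y. inner (bop_apply A x) y = inner x (bop_apply B y)"
  show "is_adjoint A B"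
    unfolding is_adjoint_def
    by (intro allI complex_eqI) (simp_all add: Re_cinner Im_cinner * bop_scaleC)
qed

lemma is_adjoint_unique:
  assumes "is_adjoint A B" "is_adjoint A C" shows "B = C"
proof (rule bop_eqI)
  fix y
  have "inner x (bop_apply B y - bop_apply C y) = 0" for x
    using assms unfolding is_adjoint_iff by (simp add: inner_diff_right)
  from this[of "bop_apply B y - bop_apply C y"] show "bop_apply B y = bop_apply C y" by simp
qed

lemma is_adjoint_exists:
  fixes A :: "'a::chilbert_space bop"
  shows "\<exists>B. is_adjoint A B"
proof -
  have "\<exists>z. \<forall>x. inner (bop_apply A x) y = inner x z" for y
  proof -
    have "bounded_linear (\<lambda>x. inner (bop_apply A x) y)"
      using bop_linear by (intro bounded_linear_intros)
    then obtain z where "\<And>x. inner (bop_apply A x) y = inner x z"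
      using riesz_representation[of "\<lambda>x. inner (bop_apply A x) y"] by blast
    then show ?thesis by blast
  qed
  then obtain g where g: "\<And>x y. inner (bop_apply A x) y = inner x (g y)" by metis
  have eqI: "u = v" if "\<And>x. inner x u = inner x v" for u v :: 'a
    using that[of "u - v"] by (metis inner_diff_right inner_eq_zero_iff right_minus_eq)
  obtain K where K: "\<And>x. norm (bop_apply A x) \<le> norm x * K" "K > 0"
    using bounded_linear.pos_bounded[OF bop_linear] by metis
  have "bounded_linear g"
  proof (rule bounded_linear_intro)
    show "g (x + y) = g x + g y" for x y
      by (rule eqI) (simp add: g[symmetric] inner_add_right)
    show "g (r *\<^sub>R x) = r *\<^sub>R g x" for r x
      by (rule eqI) (simp add: g[symmetric])
    show "norm (g x) \<le> norm x * K" for x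
    proof (cases "g x = 0")
      case False
      have "norm (g x) ^ 2 = inner (bop_apply A (g x)) x"
        by (simp add: g power2_norm_eq_inner)
      also have "\<dots> \<le> norm (bop_apply A (g x)) * norm x"
        by (rule norm_cauchy_schwarz)
      also have "\<dots> \<le> norm (g x) * K * norm x"
        by (intro mult_right_mono K) simp
      finally show ?thesis
        using False by (simp add: power2_eq_square mult.commute mult.left_commute)
    qed (use K in simp)
  qed
  moreover have "g (c *\<^sub>C x) = c *\<^sub>C g x" for c x
  proof (rule eqI)
    fix u
    show "inner u (g (c *\<^sub>C x)) = inner u (c *\<^sub>C g x)"
      using inner_scaleC[of "cnj c" u "g x"] inner_scaleC[of "cnj c" "bop_apply A u" x]
      by (simp add: g[symmetric] bop_scaleC)
  qed
  ultimately have "bounded_clinear g" by (simp add: bounded_clinear_def)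
  then show ?thesis
    by (intro exI[of _ "Bop g"]) (simp add: is_adjoint_iff g Bop_inverse)
qed

lemma is_adjoint_adj: "is_adjoint A (adj A)"
  unfolding adj_def using is_adjoint_exists is_adjoint_unique by (metis theI')

lemma adj_eqI: "is_adjoint A B \<Longrightarrow> adj A = B"
  using is_adjoint_adj is_adjoint_unique by blast

lemma adj_inner: "inner (bop_apply A x) y = inner x (bop_apply (adj A) y)"
  using is_adjoint_adj[of A] by (simp add: is_adjoint_iff)

lemma adj_inner': "inner x (bop_apply A y) = inner (bop_apply (adj A) x) y"
  using adj_inner[of A y x] by (simp add: inner_commute)

lemma adj_cinner: "cinner (bop_apply A x) y = cinner x (bop_apply (adj A) y)"
  using is_adjoint_adj[of A] by (simp add: is_adjoint_def)

lemma adj_adj [simp]: "adj (adj A) = A"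
  by (rule adj_eqI) (simp add: is_adjoint_iff adj_inner')

lemma adj_mult [simp]: "adj (A * B) = adj B * adj A"
  by (rule adj_eqI) (simp add: is_adjoint_iff adj_inner)

lemma adj_add [simp]: "adj (A + B) = adj A + adj B"
  by (rule adj_eqI) (simp add: is_adjoint_iff adj_inner inner_simps)

lemma adj_diff [simp]: "adj (A - B) = adj A - adj B"
  by (rule adj_eqI) (simp add: is_adjoint_iff adj_inner inner_simps)

lemma adj_one [simp]: "adj 1 = 1"
  by (rule adj_eqI) (simp add: is_adjoint_iff)

lemma adj_zero [simp]: "adj 0 = 0"
  by (rule adj_eqI) (simp add: is_adjoint_iff)

lemma adj_scaleR [simp]: "adj (r *\<^sub>R A) = r *\<^sub>R adj A"
  by (rule adj_eqI) (simp add: is_adjoint_iff adj_inner inner_simps)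

lemma adj_sum: "adj (\<Sum>i\<in>I. f i) = (\<Sum>i\<in>I. adj (f i))"
  by (induction I rule: infinite_finite_induct) simp_all

section \<open>Positive operators and their square roots\<close>

text \<open>Polarization, which relies on complex scalars.\<close>

lemma quadratic_form_zero:
  fixes Z :: "'a::complex_inner bop"
  assumes "\<And>x. cinner (bop_apply Z x) x = 0"
  shows "Z = 0"
proof (rule bop_eqI)
  fix x
  let ?z = "bop_apply Z"
  have *: "cinner (?z x) y + cinner (?z y) x = 0" for x y
    using assms[of "x + y"] assms[of x] assms[of y]
    by (simp add: bop_linear_simps cinner_add_left cinner_add_right algebra_simps)
  have "cinner (?z x) y = 0" for y
    using *[of x y] *[of x "\<i> *\<^sub>C y"]
    by (simp add: bop_scaleC cinner_scaleC_left cinner_scaleC_right complex_eq_iff)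
  from this[of "?z x"] have "inner (?z x) (?z x) = 0"
    by (simp add: Re_cinner[symmetric])
  then show "?z x = bop_apply 0 x" by simp
qed

lemma positive_op_iff:
  fixes A :: "'a::chilbert_space bop"
  shows "positive_op A \<longleftrightarrow> adj A = A \<and> (\<forall>x. inner (bop_apply A x) x \<ge> 0)"
proof
  assume A: "positive_op A"
  then have "Im (cinner (bop_apply A x) x) = 0" and Re: "Re (cinner (bop_apply A x) x) \<ge> 0" for x
    by (simp_all add: positive_op_def complex_nonneg_Reals_iff)
  then have "cinner (bop_apply (adj A - A) x) x = 0" for x
  proof -
    have "cinner (bop_apply (adj A) x) x = cnj (cinner (bop_apply A x) x)"
      by (metis adj_cinner cinner_commute adj_adj)
    then have "cinner (bop_apply (adj A) x) x = cinner (bop_apply A x) x"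
      using \<open>\<And>x. Im (cinner (bop_apply A x) x) = 0\<close> by (simp add: complex_eq_iff)
    moreover have "bop_apply (adj A) x = bop_apply (adj A - A) x + bop_apply A x" by simp
    ultimately show ?thesis by (metis add_cancel_left_left cinner_add_left)
  qed
  then have "adj A - A = 0" by (rule quadratic_form_zero)
  then show "adj A = A \<and> (\<forall>x. inner (bop_apply A x) x \<ge> 0)"
    using Re by (simp add: Re_cinner)
next
  assume A: "adj A = A \<and> (\<forall>x. inner (bop_apply A x) x \<ge> 0)"
  then have "cinner (bop_apply A x) x = cnj (cinner (bop_apply A x) x)" for x
    by (metis adj_cinner cinner_commute)
  then have "Im (cinner (bop_apply A x) x) = 0" for x
    by (metis Reals_cnj_iff complex_is_Real_iff)
  then show "positive_op A"
    using A by (simp add: positive_op_def complex_nonneg_Reals_iff Re_cinner)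
qed

subsection \<open>Existence and uniqueness of square roots\<close>

lemma strong_limit:
  fixes Y :: "nat \<Rightarrow> 'a::complex_inner bop"
  assumes conv: "\<And>x. convergent (\<lambda>n. bop_apply (Y n) x)"
    and bound: "\<And>n x. norm (bop_apply (Y n) x) \<le> norm x"
  obtains Z where "\<And>x. (\<lambda>n. bop_apply (Y n) x) \<longlonglongrightarrow> bop_apply Z x"
proof -
  obtain g where g: "\<And>x. (\<lambda>n. bop_apply (Y n) x) \<longlonglongrightarrow> g x"
    using conv unfolding convergent_def by metis
  have norm_g: "norm (g x) \<le> norm x" for x
    by (rule LIMSEQ_le_const2[OF tendsto_norm[OF g]]) (use bound in blast)
  have "bounded_linear g"
  proof (rule bounded_linear_intro)
    show "g (x + y) = g x + g y" for x y
      using LIMSEQ_unique[OF g[of "x + y"]] tendsto_add[OF g[of x] g[of y]]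
      by (simp add: bop_linear_simps)
    show "g (r *\<^sub>R x) = r *\<^sub>R g x" for r x
      using LIMSEQ_unique[OF g[of "r *\<^sub>R x"]] tendsto_scaleR[OF tendsto_const g[of x]]
      by (simp add: bop_linear_simps)
    show "norm (g x) \<le> norm x * 1" for x
      using norm_g by simp
  qed
  moreover have "g (c *\<^sub>C x) = c *\<^sub>C g x" for c x
  proof -
    have [simp]: "norm (c *\<^sub>C y) = cmod c * norm y" for y :: 'a
    proof -
      have "norm (c *\<^sub>C y) ^ 2 = Re (c * cnj c * cinner y y)"
        unfolding power2_norm_eq_inner Re_cinner[symmetric] cinner_scaleC_left cinner_scaleC_right
        by (simp only: mult.assoc mult.left_commute[of "cnj c" c])
      also have "c * cnj c * cinner y y = complex_of_real (cmod c ^ 2) * cinner y y"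
        by (simp only: complex_norm_square)
      also have "Re \<dots> = (cmod c * norm y) ^ 2"
        by (simp add: Re_cinner power_mult_distrib power2_norm_eq_inner)
      finally show ?thesis
        by (simp add: power2_eq_iff_nonneg)
    qed
    have "(\<lambda>n. norm (c *\<^sub>C bop_apply (Y n) x - c *\<^sub>C g x)) \<longlonglongrightarrow> cmod c * norm (g x - g x)"
      unfolding scaleC_diff_right[symmetric] \<open>\<And>y. norm (c *\<^sub>C y) = cmod c * norm y\<close>
      by (intro tendsto_intros g)
    then have "(\<lambda>n. bop_apply (Y n) (c *\<^sub>C x)) \<longlonglongrightarrow> c *\<^sub>C g x"
      by (simp add: bop_scaleC LIM_zero_cancel tendsto_norm_zero_iff)
    then show ?thesis
      using LIMSEQ_unique[OF g[of "c *\<^sub>C x"]] by simp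
  qed
  ultimately have "bop_apply (Bop g) = g"
    by (simp add: Bop_inverse bounded_clinear_def)
  with g show ?thesis using that[of "Bop g"] by simp
qed

text \<open>The iteration \<open>Y \<mapsto> (B + Y\<^sup>2) / 2\<close> on operators, started at \<open>0\<close>, converges strongly if
  \<open>B\<close> is a contraction; if \<open>Z\<close> is the limit, then \<open>(I - Z)\<^sup>2 = I - B\<close>. The scalar sequence
  \<open>sqrt_bound\<close> is the case \<open>B = 1\<close> of this iteration. It dominates the iterates and their increments
  in norm.\<close>

primrec sqrt_bound :: "nat \<Rightarrow> real" where
  "sqrt_bound 0 = 0"
| "sqrt_bound (Suc n) = (1 + sqrt_bound n ^ 2) / 2"

lemma sqrt_bound_range: "0 \<le> sqrt_bound n \<and> sqrt_bound n \<le> 1"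
proof (induction n)
  case (Suc n)
  then have "sqrt_bound n ^ 2 \<le> 1" by (simp add: power_le_one)
  then show ?case by simp
qed simp

primrec sqrt_iter :: "'a::complex_inner bop \<Rightarrow> nat \<Rightarrow> 'a bop" where
  "sqrt_iter B 0 = 0"
| "sqrt_iter B (Suc n) = (1/2) *\<^sub>R (B + sqrt_iter B n * sqrt_iter B n)"

lemma sqrt_iter_commute:
  assumes "B * R = R * B"
  shows "sqrt_iter B n * R = R * sqrt_iter B n"
proof (induction n)
  case (Suc n)
  then have "sqrt_iter B n * sqrt_iter B n * R = R * (sqrt_iter B n * sqrt_iter B n)"
    by (metis mult.assoc)
  then show ?case using assms by (simp add: distrib_left distrib_right)
qed simp

lemma sqrt_iter_norm:
  assumes B: "\<And>x. norm (bop_apply B x) \<le> norm x"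
  shows "norm (bop_apply (sqrt_iter B n) x) \<le> sqrt_bound n * norm x"
proof (induction n arbitrary: x)
  case (Suc n)
  let ?Y = "bop_apply (sqrt_iter B n)"
  have "norm (?Y (?Y x)) \<le> sqrt_bound n * (sqrt_bound n * norm x)"
    using Suc[of "?Y x"] mult_left_mono[OF Suc[of x], of "sqrt_bound n"] sqrt_bound_range[of n]
    by linarith
  then have "norm (bop_apply B x + ?Y (?Y x)) \<le> norm x + sqrt_bound n * (sqrt_bound n * norm x)"
    using B[of x] norm_triangle_ineq[of "bop_apply B x" "?Y (?Y x)"] by linarith
  then show ?case
    by (simp add: scaleR_add_right[symmetric] power2_eq_square algebra_simps del: scaleR_add_right)
qed simp

lemma sqrt_iter_diff_norm:
  assumes B: "\<And>x. norm (bop_apply B x) \<le> norm x"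
  shows "norm (bop_apply (sqrt_iter B (Suc n)) x - bop_apply (sqrt_iter B n) x)
    \<le> (sqrt_bound (Suc n) - sqrt_bound n) * norm x"
proof (induction n arbitrary: x)
  case 0
  then show ?case using B[of x] by simp
next
  case (Suc n)
  define U where "U = sqrt_iter B (Suc n)"
  define V where "V = sqrt_iter B n"
  define u where "u = sqrt_bound (Suc n)"
  define v where "v = sqrt_bound n"
  \<comment> \<open>The iterates commute, so \<open>U\<^sup>2 - V\<^sup>2\<close> factors.\<close>
  have "U * V = V * U"
    unfolding U_def V_def
    by (rule sqrt_iter_commute, rule sqrt_iter_commute[symmetric], rule refl)
  then have "(U + V) * (U - V) = U * U - V * V"
    by (simp add: algebra_simps)
  moreover have "sqrt_iter B (Suc (Suc n)) = (1/2) *\<^sub>R (B + U * U)" "U = (1/2) *\<^sub>R (B + V * V)"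
    by (simp_all only: U_def V_def sqrt_iter.simps)
  ultimately have "sqrt_iter B (Suc (Suc n)) - U = (1/2) *\<^sub>R ((U + V) * (U - V))"
    by (simp only: scaleR_diff_right[symmetric] add_diff_cancel_left)
  from arg_cong[OF this, of "\<lambda>Z. bop_apply Z x"]
  have eq: "bop_apply (sqrt_iter B (Suc (Suc n))) x - bop_apply U x
      = (1/2) *\<^sub>R (bop_apply U (bop_apply (U - V) x) + bop_apply V (bop_apply (U - V) x))"
    by (simp only: bop_simps(3,4,6,7))
  have IH: "norm (bop_apply (U - V) x) \<le> (u - v) * norm x"
    using Suc[of x] by (simp only: U_def V_def u_def v_def bop_simps)
  have uv: "0 \<le> u" "0 \<le> v"
    using sqrt_bound_range by (simp_all only: u_def v_def)
  have "norm (bop_apply (sqrt_iter B (Suc (Suc n))) x - bop_apply U x)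
      \<le> (1/2) * (norm (bop_apply U (bop_apply (U - V) x)) + norm (bop_apply V (bop_apply (U - V) x)))"
    unfolding eq norm_scaleR by (simp add: norm_triangle_ineq del: bop_simps)
  also have "\<dots> \<le> (1/2) * (u * norm (bop_apply (U - V) x) + v * norm (bop_apply (U - V) x))"
    using sqrt_iter_norm[OF B, of "Suc n" "bop_apply (U - V) x", folded U_def u_def]
      sqrt_iter_norm[OF B, of n "bop_apply (U - V) x", folded V_def v_def]
    by (intro mult_left_mono add_mono) simp_all
  also have "\<dots> = (1/2) * (u + v) * norm (bop_apply (U - V) x)"
    by (simp add: algebra_simps)
  also have "\<dots> \<le> (1/2) * (u + v) * ((u - v) * norm x)"
    using uv IH by (intro mult_left_mono) auto
  also have "\<dots> = (sqrt_bound (Suc (Suc n)) - u) * norm x"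
  proof -
    have *: "a - u = (1/2) * (u + v) * (u - v)"
      if "a = (1 + u ^ 2) / 2" "u = (1 + v ^ 2) / 2" for a u v :: real
    proof -
      have "a - u = (1 + u ^ 2) / 2 - (1 + v ^ 2) / 2"
        by (rule arg_cong2[of _ _ _ _ "(-)"]) (fact that)+
      also have "\<dots> = (u ^ 2 - v ^ 2) / 2" by (simp add: field_simps)
      finally have "a - u = (u ^ 2 - v ^ 2) / 2" .
      then show ?thesis by (simp only: power2_eq_square square_diff_square_factored)
    qed
    have "sqrt_bound (Suc (Suc n)) - u = (1/2) * (u + v) * (u - v)"
      by (rule *) (simp_all only: u_def v_def sqrt_bound.simps)
    then show ?thesis by simp
  qed
  finally show ?case by (simp only: U_def u_def)
qed

lemma sqrt_iter_convergent:
  fixes B :: "'a::chilbert_space bop"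
  assumes B: "\<And>x. norm (bop_apply B x) \<le> norm x"
  shows "convergent (\<lambda>n. bop_apply (sqrt_iter B n) x)"
proof -
  have mono: "sqrt_bound n \<le> sqrt_bound (Suc n)" for n
    using zero_le_power2[of "sqrt_bound n - 1"] by (simp add: power2_diff)
  have "convergent sqrt_bound"
    using sqrt_bound_range mono
    by (intro Bseq_mono_convergent BseqI'[of _ 1]) (auto simp: incseq_Suc_iff intro: lift_Suc_mono_le)
  then have "summable (\<lambda>n. sqrt_bound (Suc n) - sqrt_bound n)"
    using telescope_summable unfolding convergent_def by blast
  then have "summable (\<lambda>n. (sqrt_bound (Suc n) - sqrt_bound n) * norm x)"
    by (rule summable_mult2)
  then have "summable (\<lambda>n. norm (bop_apply (sqrt_iter B (Suc n)) x - bop_apply (sqrt_iter B n) x))"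
    by (rule summable_comparison_test')
      (simp only: real_norm_def abs_norm_cancel, rule sqrt_iter_diff_norm[OF B])
  then have "summable (\<lambda>n. bop_apply (sqrt_iter B (Suc n)) x - bop_apply (sqrt_iter B n) x)"
    by (rule summable_norm_cancel)
  then have "convergent (\<lambda>n. \<Sum>i<n. bop_apply (sqrt_iter B (Suc i)) x - bop_apply (sqrt_iter B i) x)"
    by (simp add: summable_iff_convergent)
  then show ?thesis 
    by (simp only: sum_lessThan_telescope[of "\<lambda>n. bop_apply (sqrt_iter B n) x"]) simp
qed

text \<open>The last conclusion, that the square root commutes with whatever commutes with \<open>B\<close>, is needed for
  uniqueness.\<close>

lemma square_root_exists:
  fixes B :: "'a::chilbert_space bop"
  assumes B: "\<And>x. norm (bop_apply B x) \<le> norm x" and adj_B: "adj B = B"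
  obtains S where "positive_op S" "S * S = 1 - B" "\<And>R. B * R = R * B \<Longrightarrow> S * R = R * S"
proof -
  define Y where "Y = sqrt_iter B"
  have norm_Y: "norm (bop_apply (Y n) x) \<le> norm x" for n x
    using sqrt_iter_norm[OF B, of n x] sqrt_bound_range[of n]
    by (metis Y_def dual_order.trans mult_left_le_one_le norm_ge_zero)
  obtain Z where Z: "\<And>x. (\<lambda>n. bop_apply (Y n) x) \<longlonglongrightarrow> bop_apply Z x"
    using strong_limit[of Y] sqrt_iter_convergent[OF B] norm_Y unfolding Y_def by blast
  have norm_Z: "norm (bop_apply Z x) \<le> norm x" for x
    by (rule LIMSEQ_le_const2[OF tendsto_norm[OF Z]]) (use norm_Y in blast)
  have adj_Y: "adj (Y n) = Y n" for n
    unfolding Y_def by (induction n) (simp_all add: adj_B)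
  have adj_Z: "adj Z = Z"
  proof (rule adj_eqI, unfold is_adjoint_iff, intro allI)
    fix x y
    have "(\<lambda>n. inner (bop_apply (Y n) x) y) \<longlonglongrightarrow> inner (bop_apply Z x) y"
      "(\<lambda>n. inner x (bop_apply (Y n) y)) \<longlonglongrightarrow> inner x (bop_apply Z y)"
      by (intro tendsto_intros Z)+
    moreover have "inner (bop_apply (Y n) x) y = inner x (bop_apply (Y n) y)" for n
      by (simp add: adj_inner adj_Y)
    ultimately show "inner (bop_apply Z x) y = inner x (bop_apply Z y)"
      by (simp add: LIMSEQ_unique)
  qed
  have "bop_apply Z x = bop_apply ((1/2) *\<^sub>R (B + Z * Z)) x" for x
  proof (rule LIMSEQ_unique)
    show "(\<lambda>n. bop_apply (Y (Suc n)) x) \<longlonglongrightarrow> bop_apply Z x"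
      using Z by (rule LIMSEQ_Suc)
    have "(\<lambda>n. bop_apply (Y n) (bop_apply (Y n) x - bop_apply Z x)) \<longlonglongrightarrow> 0"
    proof (rule Lim_null_comparison)
      show "\<forall>\<^sub>F n in sequentially. norm (bop_apply (Y n) (bop_apply (Y n) x - bop_apply Z x))
          \<le> norm (bop_apply (Y n) x - bop_apply Z x)"
        using norm_Y by simp
      show "(\<lambda>n. norm (bop_apply (Y n) x - bop_apply Z x)) \<longlonglongrightarrow> 0"
        using Z[of x] LIM_zero tendsto_norm_zero by blast
    qed
    from tendsto_add[OF this Z[of "bop_apply Z x"]]
    have "(\<lambda>n. bop_apply (Y n) (bop_apply (Y n) x)) \<longlonglongrightarrow> bop_apply Z (bop_apply Z x)"
      by (simp add: bop_linear_simps)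
    from tendsto_scaleR[OF tendsto_const tendsto_add[OF tendsto_const this]]
    show "(\<lambda>n. bop_apply (Y (Suc n)) x) \<longlonglongrightarrow> bop_apply ((1/2) *\<^sub>R (B + Z * Z)) x"
      by (simp add: Y_def)
  qed
  then have "Z = (1/2) *\<^sub>R (B + Z * Z)" by (rule bop_eqI)
  then have "2 *\<^sub>R Z = 2 *\<^sub>R ((1/2) *\<^sub>R (B + Z * Z))" by (rule arg_cong)
  then have ZZ: "Z + Z = B + Z * Z" by (simp only: scaleR_scaleR scaleR_2) simp
  show ?thesis
  proof (rule that[of "1 - Z"])
    have "inner (bop_apply Z x) x \<le> inner x x" for x
    proof -
      have "inner (bop_apply Z x) x \<le> norm (bop_apply Z x) * norm x"
        by (rule norm_cauchy_schwarz)
      also have "\<dots> \<le> norm x * norm x" by (intro mult_right_mono norm_Z) simp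
      finally show ?thesis by (simp add: power2_norm_eq_inner[symmetric] power2_eq_square)
    qed
    then show "positive_op (1 - Z)"
      by (simp add: positive_op_iff adj_Z inner_diff_left)
    have "(1 - Z) * (1 - Z) = 1 - (Z + Z) + Z * Z" by (simp add: algebra_simps)
    then show "(1 - Z) * (1 - Z) = 1 - B" by (simp add: ZZ)
    fix R assume "B * R = R * B"
    then have YR: "Y n * R = R * Y n" for n unfolding Y_def by (rule sqrt_iter_commute)
    have "Z * R = R * Z"
    proof (rule bop_eqI)
      fix x
      have "(\<lambda>n. bop_apply (Y n) (bop_apply R x)) \<longlonglongrightarrow> bop_apply Z (bop_apply R x)"
        by (rule Z)
      moreover have "(\<lambda>n. bop_apply R (bop_apply (Y n) x)) \<longlonglongrightarrow> bop_apply R (bop_apply Z x)"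
        by (intro bounded_linear.tendsto[OF bop_linear] Z)
      ultimately show "bop_apply (Z * R) x = bop_apply (R * Z) x"
        using YR by (simp add: LIMSEQ_unique bop_simps(6)[symmetric] del: bop_simps(6))
    qed
    then show "(1 - Z) * R = R * (1 - Z)" by (simp add: algebra_simps)
  qed
qed

lemma square_root_unique:
  fixes S R :: "'a::chilbert_space bop"
  assumes pos: "positive_op S" "positive_op R" and sq: "S * S = R * R" and comm: "S * R = R * S"
  shows "S = R"
proof -
  \<comment> \<open>With \<open>d = S - R\<close>, the positive operators \<open>d S d\<close> and \<open>d R d\<close> add up to \<open>d (S\<^sup>2 - R\<^sup>2) = 0\<close>. So both
    vanish, \<open>d\<^sup>3 = d S d - d R d = 0\<close>, and the self-adjoint operator \<open>d\<close> vanishes as well.\<close>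
  define d where "d = S - R"
  have adj: "adj S = S" "adj R = R" "adj d = d"
    using pos by (simp_all add: positive_op_iff d_def)
  have sum0: "d * S * d + d * R * d = 0"
  proof -
    have "(S + R) * d = 0" by (simp add: d_def algebra_simps sq comm)
    then have "d * ((S + R) * d) = 0" by simp
    then show ?thesis by (simp add: algebra_simps)
  qed
  have pos': "cinner (bop_apply (d * P * d) x) x \<in> \<real>\<^sub>\<ge>\<^sub>0" if "positive_op P" for P x
    using that unfolding positive_op_def by (simp add: adj_cinner adj) (metis adj(3) adj_cinner)
  have zero: "cinner (bop_apply (d * S * d) x) x = 0 \<and> cinner (bop_apply (d * R * d) x) x = 0" for x
  proof -
    have "cinner (bop_apply (d * S * d) x) x + cinner (bop_apply (d * R * d) x) x = 0"
      using arg_cong[OF sum0, of "\<lambda>Z. cinner (bop_apply Z x) x"] cinner_add_left[of 0 0 x]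
      by (simp add: cinner_add_left)
    then show ?thesis
      using pos'[OF pos(1), of x] pos'[OF pos(2), of x]
      by (simp add: complex_nonneg_Reals_iff complex_eq_iff)
  qed
  have "d * S * d = 0" "d * R * d = 0"
    using zero by (auto intro!: quadratic_form_zero)
  moreover have "d * d * d = d * S * d - d * R * d"
    by (subst (2) d_def) (simp only: left_diff_distrib right_diff_distrib)
  ultimately have d3: "d * d * d = 0" by simp
  have null: "Z = 0" if "adj Z = Z" "Z * Z = 0" for Z :: "'a bop"
  proof (rule bop_eqI)
    fix x
    have "inner (bop_apply Z x) (bop_apply Z x) = inner x (bop_apply (Z * Z) x)"
      by (simp add: adj_inner that(1))
    then show "bop_apply Z x = bop_apply 0 x" by (simp add: that(2))
  qed
  have "d * d * (d * d) = d * d * d * d" by (simp only: mult.assoc)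
  then have "d * d * (d * d) = 0" by (simp only: d3 mult_zero_left)
  then have "d * d = 0" by (rule null[rotated]) (simp add: adj)
  then have "d = 0" by (rule null[OF adj(3)])
  then show ?thesis by (simp add: d_def)
qed

lemma contraction_adj_mult_norm:
  fixes X :: "'a::chilbert_space bop"
  assumes "contraction X"
  shows "norm (bop_apply (adj X) y) \<le> norm y"
proof (cases "bop_apply (adj X) y = 0")
  case False
  let ?z = "bop_apply (adj X) y"
  have "norm ?z ^ 2 = inner (bop_apply X ?z) y"
    by (simp add: adj_inner power2_norm_eq_inner)
  also have "\<dots> \<le> norm (bop_apply X ?z) * norm y" by (rule norm_cauchy_schwarz)
  also have "\<dots> \<le> norm ?z * norm y"
    using assms by (intro mult_right_mono) (simp_all add: contraction_def)
  finally show ?thesis using False by (simp add: power2_eq_square)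
qed simp

lemma defect_square:
  fixes X :: "'a::chilbert_space bop"
  assumes X: "contraction X"
  shows "defect X * defect X = 1 - adj X * X"
proof -
  define B where "B = adj X * X"
  have "norm (bop_apply B x) \<le> norm x" for x
    using contraction_adj_mult_norm[OF X, of "bop_apply X x"] X
    by (simp add: B_def contraction_def) (meson order_trans)
  moreover have "adj B = B" by (simp add: B_def)
  ultimately obtain S where S: "positive_op S" "S * S = 1 - B"
    and comm: "\<And>R. B * R = R * B \<Longrightarrow> S * R = R * S"
    using square_root_exists[of B] by blast
  have "S = R" if R: "positive_op R" "R * R = 1 - B" for R
  proof (rule square_root_unique[OF S(1) R(1)])
    have B: "B = 1 - R * R" using R by simp
    have "B * R = R * B" unfolding B by (simp add: algebra_simps)
    then show "S * R = R * S" by (rule comm)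
  qed (simp add: S R)
  then have "\<exists>!S. positive_op S \<and> S * S = 1 - B" using S by blast
  from theI'[OF this] show ?thesis unfolding defect_def op_sqrt_def B_def by blast
qed

section \<open>Alternating sums over subsets\<close>

text \<open>The sum of \<open>f K\<close> over the subsets \<open>K\<close> of \<open>L\<close>, signed by the parity of \<open>card K\<close>.\<close>

definition alt_sum :: "'n set \<Rightarrow> ('n set \<Rightarrow> 'b) \<Rightarrow> 'b::real_vector" where
  "alt_sum L f = (\<Sum>K\<in>Pow L. (- 1) ^ card K *\<^sub>R f K)"

lemma sum_Pow_insert:
  assumes "k \<notin> L" "finite L"
  shows "(\<Sum>K\<in>Pow (insert k L). f K) = (\<Sum>K\<in>Pow L. f K) + (\<Sum>K\<in>Pow L. f (insert k K))"
proof -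
  have "inj_on (insert k) (Pow L)"
    using assms by (auto simp: inj_on_def)
  moreover have "Pow L \<inter> insert k ` Pow L = {}"
    using assms by auto
  moreover have "finite (Pow L)" "finite (insert k ` Pow L)"
    using assms by simp_all
  ultimately show ?thesis
    by (simp only: Pow_insert sum.union_disjoint sum.reindex o_def)
qed

lemma alt_sum_cong: "(\<And>K. K \<subseteq> L \<Longrightarrow> f K = g K) \<Longrightarrow> alt_sum L f = alt_sum L g"
  unfolding alt_sum_def by (intro sum.cong) auto

lemma alt_sum_empty [simp]: "alt_sum {} f = f {}"
  by (simp add: alt_sum_def)

lemma alt_sum_insert:
  assumes "k \<notin> L" "finite L"
  shows "alt_sum (insert k L) f = alt_sum L (\<lambda>K. f K - f (insert k K))"
proof -
  have "(\<Sum>K\<in>Pow L. (- 1) ^ card (insert k K) *\<^sub>R f (insert k K))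
      = (\<Sum>K\<in>Pow L. - ((- 1) ^ card K *\<^sub>R f (insert k K)))"
  proof (rule sum.cong[OF refl])
    fix K assume "K \<in> Pow L"
    then have "finite K" "k \<notin> K" using assms by (auto dest: finite_subset)
    then show "(- 1) ^ card (insert k K) *\<^sub>R f (insert k K) = - ((- 1) ^ card K *\<^sub>R f (insert k K))"
      by simp
  qed
  then show ?thesis
    unfolding alt_sum_def sum_Pow_insert[OF assms]
    by (simp add: sum_negf scaleR_diff_right sum_subtractf)
qed

lemma alt_sum_diff: "alt_sum L (\<lambda>K. f K - g K) = alt_sum L f - alt_sum L g"
  by (simp add: alt_sum_def scaleR_diff_right sum_subtractf)

lemma alt_sum_mult_left: "a * alt_sum L f = alt_sum L (\<lambda>K. a * f K :: 'b::real_algebra)"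
  by (simp add: alt_sum_def sum_distrib_left)

lemma alt_sum_mult_right: "alt_sum L f * a = alt_sum L (\<lambda>K. f K * a :: 'b::real_algebra)"
  by (simp add: alt_sum_def sum_distrib_right)

lemma alt_sum_adj: "adj (alt_sum L f) = alt_sum L (\<lambda>K. adj (f K))"
  by (simp add: alt_sum_def adj_sum)

lemma alt_sum_zero: "(\<And>K. K \<subseteq> L \<Longrightarrow> f K = 0) \<Longrightarrow> alt_sum L f = 0"
  by (simp add: alt_sum_def)

lemma alt_sum_restrict:
  assumes "L' \<subseteq> L" "finite L" "\<And>K. K \<subseteq> L \<Longrightarrow> \<not> K \<subseteq> L' \<Longrightarrow> f K = 0"
  shows "alt_sum L f = alt_sum L' f"
  unfolding alt_sum_def
  by (rule sum.mono_neutral_right) (use assms in auto)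

section \<open>Commuting tuples and the coordinates of the dilation\<close>

locale commuting_tuple =
  fixes T :: "'n::{finite,linorder} \<Rightarrow> 'a::chilbert_space bop"
  assumes comm: "T i * T j = T j * T i"
begin

abbreviation Ts :: "'n \<Rightarrow> 'a bop" where "Ts i \<equiv> adj (T i)"

lemma comm_s: "Ts i * Ts j = Ts j * Ts i"
  using comm[of j i] by (metis adj_mult)

text \<open>\<open>P K\<close> is the product of the \<open>T i\<close> with \<open>i \<in> K\<close>, in any order, and \<open>Q K\<close> is its adjoint.\<close>

definition P :: "'n set \<Rightarrow> 'a bop" where
  "P K = Finite_Set.fold (\<lambda>i A. T i * A) 1 K"

definition Q :: "'n set \<Rightarrow> 'a bop" where
  "Q K = adj (P K)"

lemma P_empty [simp]: "P {} = 1"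
  by (simp add: P_def)

lemma P_insert:
  assumes "k \<notin> K" shows "P (insert k K) = T k * P K"
proof -
  interpret comp_fun_commute "\<lambda>i A. T i * A"
    by standard (simp add: fun_eq_iff mult.assoc[symmetric] comm)
  show ?thesis using assms by (simp add: P_def)
qed

lemma P_comm: "T i * P K = P K * T i"
proof (induction K rule: finite_induct[OF finite])
  case (2 k K)
  have "T i * P (insert k K) = T k * (T i * P K)"
    using P_insert[OF 2(2)] by (metis comm mult.assoc)
  then show ?case using P_insert[OF 2(2)] 2(3) by (simp only: mult.assoc)
qed simp

lemma P_union: "K \<inter> N = {} \<Longrightarrow> P (K \<union> N) = P K * P N"
proof (induction K rule: finite_induct[OF finite])
  case (2 k K)
  then show ?case by (simp add: P_insert mult.assoc)
qed simp

lemma adj_P [simp]: "adj (P K) = Q K" and adj_Q [simp]: "adj (Q K) = P K"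
  by (simp_all add: Q_def)

lemma Q_empty [simp]: "Q {} = 1"
  by (simp add: Q_def)

lemma Q_comm: "Ts i * Q K = Q K * Ts i"
  using arg_cong[OF P_comm[of i K], of adj] by simp

lemma Q_insert: "k \<notin> K \<Longrightarrow> Q (insert k K) = Ts k * Q K"
  using arg_cong[OF P_insert[of k K], of adj] by (simp add: Q_comm)

lemma Q_union: "K \<inter> N = {} \<Longrightarrow> Q (K \<union> N) = Q K * Q N"
  using arg_cong[OF P_union[of N K], of adj] by (simp add: Un_commute Int_commute)

lemma Q_remove: "k \<in> K \<Longrightarrow> Q K = Ts k * Q (K - {k})"
  using Q_insert[of k "K - {k}"] by (simp add: insert_absorb)

text \<open>\<open>S L\<close> is the operator \<open>\<Prod>\<^sub>k\<^sub>\<in>\<^sub>L (I - \<Delta>\<^bsub>T k\<^esub>)(I)\<close>, and \<open>Delta_alt L A\<close> is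
  \<open>\<Prod>\<^sub>k\<^sub>\<in>\<^sub>L (I - \<Delta>\<^bsub>T k\<^esub>)(A)\<close>, both expanded into sums over the subsets of \<open>L\<close>.\<close>

definition S :: "'n set \<Rightarrow> 'a bop" where
  "S L = alt_sum L (\<lambda>K. P K * Q K)"

definition Delta_alt :: "'n set \<Rightarrow> 'a bop \<Rightarrow> 'a bop" where
  "Delta_alt L A = alt_sum L (\<lambda>K. P K * A * Q K)"

lemma Delta_alt_empty [simp]: "Delta_alt {} A = A"
  by (simp add: Delta_alt_def)

lemma Delta_alt_insert:
  assumes "k \<notin> L"
  shows "Delta_alt (insert k L) A = Delta_alt L A - T k * Delta_alt L A * Ts k"
proof -
  have "P (insert k K) * A * Q (insert k K) = T k * (P K * A * Q K) * Ts k" if "K \<subseteq> L" for K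
  proof -
    have "k \<notin> K" using that assms by auto
    then show ?thesis by (simp add: P_insert Q_insert mult.assoc Q_comm)
  qed
  then have "alt_sum L (\<lambda>K. P (insert k K) * A * Q (insert k K))
      = alt_sum L (\<lambda>K. T k * (P K * A * Q K) * Ts k)" by (rule alt_sum_cong)
  then show ?thesis
    by (simp add: Delta_alt_def alt_sum_insert assms alt_sum_diff alt_sum_mult_left alt_sum_mult_right)
qed

lemma S_eq_Delta_alt: "S L = Delta_alt L 1"
  by (simp add: S_def Delta_alt_def)

lemma S_empty [simp]: "S {} = 1"
  by (simp add: S_eq_Delta_alt)

lemma S_insert: "k \<notin> L \<Longrightarrow> S (insert k L) = S L - T k * S L * Ts k"
  by (simp add: S_eq_Delta_alt Delta_alt_insert)

lemma adj_S [simp]: "adj (S L) = S L"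
  by (simp add: S_def alt_sum_adj)

lemma foldr_Delta:
  assumes "distinct ks"
  shows "foldr (\<lambda>k F. (\<lambda>A. A - Delta (T k) A) \<circ> F) ks id A = Delta_alt (set ks) A"
  using assms
proof (induction ks)
  case (Cons k ks)
  then show ?case by (simp add: Delta_alt_insert Delta_def)
qed simp

lemma Delta_prod_eq: "Delta_prod T K A = Delta_alt K A"
  unfolding Delta_prod_def by (subst foldr_Delta) simp_all

text \<open>This expands \<open>I = \<Prod>\<^sub>k\<^sub>\<in>\<^sub>J (\<Delta>\<^bsub>T k\<^esub> + (I - \<Delta>\<^bsub>T k\<^esub>))(I)\<close>. In the dilation picture it
  says that the coordinates \<open>Q N\<close> embed \<open>\<H>\<close> isometrically.\<close>

lemma sum_P_S_Q: "(\<Sum>N\<in>Pow J. P N * S (J - N) * Q N) = 1"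
proof (induction J rule: finite_induct[OF finite])
  case 1
  show ?case by simp
next
  case (2 k J)
  have k: "k \<notin> J" by fact
  have "(\<Sum>N\<in>Pow J. P N * S (insert k J - N) * Q N)
      = (\<Sum>N\<in>Pow J. P N * S (J - N) * Q N - T k * (P N * S (J - N) * Q N) * Ts k)"
  proof (intro sum.cong refl)
    fix N assume "N \<in> Pow J"
    with k have "insert k J - N = insert k (J - N)" by auto
    then have "S (insert k J - N) = S (J - N) - T k * S (J - N) * Ts k"
      using k by (simp add: S_insert)
    moreover have "P N * (T k * S (J - N) * Ts k) * Q N = T k * (P N * S (J - N) * Q N) * Ts k"
    proof -
      have "P N * (T k * S (J - N) * Ts k) * Q N = (P N * T k) * S (J - N) * (Ts k * Q N)"
        by (simp only: mult.assoc)
      also have "\<dots> = T k * (P N * S (J - N) * Q N) * Ts k"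
        unfolding P_comm[symmetric] Q_comm by (simp only: mult.assoc)
      finally show ?thesis .
    qed
    ultimately show "P N * S (insert k J - N) * Q N
        = P N * S (J - N) * Q N - T k * (P N * S (J - N) * Q N) * Ts k"
      by (simp only: left_diff_distrib right_diff_distrib)
  qed
  moreover have "(\<Sum>N\<in>Pow J. P (insert k N) * S (insert k J - insert k N) * Q (insert k N))
      = (\<Sum>N\<in>Pow J. T k * (P N * S (J - N) * Q N) * Ts k)"
  proof (intro sum.cong refl)
    fix N assume "N \<in> Pow J"
    with k have "k \<notin> N" "insert k J - insert k N = J - N" by auto
    then show "P (insert k N) * S (insert k J - insert k N) * Q (insert k N)
        = T k * (P N * S (J - N) * Q N) * Ts k"
      by (simp add: P_insert Q_insert mult.assoc Q_comm)
  qed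
  ultimately show ?case
    using 2 k by (simp add: sum_Pow_insert sum_subtractf)
qed

text \<open>The coordinate at \<open>N\<close> of the map \<open>\<beta>\<^sub>i\<close> that sends \<open>h\<close> to \<open>V\<^sub>i h - T\<^sub>i h\<close>.\<close>

definition B :: "'n \<Rightarrow> 'n set \<Rightarrow> 'a bop" where
  "B i N = (if i \<in> N then Q (N - {i}) else 0) - Q N * T i"

text \<open>The orthogonality of the range of \<open>\<beta>\<^sub>i\<close> to \<open>\<H>\<close>. The general \<open>J\<close> serves for the vectors
  \<open>V\<^sub>K \<beta>\<^sub>i h\<close>, whose coordinates vanish except at the sets that contain \<open>K\<close>.\<close>

lemma sum_P_S_B:
  assumes "i \<in> J"
  shows "(\<Sum>N\<in>Pow J. P N * S (J - N) * B i N) = 0"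
proof -
  obtain J' where J: "J = insert i J'" "i \<notin> J'"
    using assms by (meson mk_disjoint_insert)
  have "(\<Sum>N\<in>Pow J. P N * S (J - N) * (if i \<in> N then Q (N - {i}) else 0))
      = (\<Sum>N\<in>Pow J'. T i * (P N * S (J' - N) * Q N))"
  proof -
    have "(\<Sum>N\<in>Pow J'. P N * S (J - N) * (if i \<in> N then Q (N - {i}) else 0)) = 0"
      using J by (intro sum.neutral) auto
    moreover have "(\<Sum>N\<in>Pow J'. P (insert i N) * S (J - insert i N) * Q (insert i N - {i}))
        = (\<Sum>N\<in>Pow J'. T i * (P N * S (J' - N) * Q N))"
    proof (intro sum.cong refl)
      fix N assume "N \<in> Pow J'"
      with J have "i \<notin> N" "J - insert i N = J' - N" "insert i N - {i} = N" by auto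
      then show "P (insert i N) * S (J - insert i N) * Q (insert i N - {i})
          = T i * (P N * S (J' - N) * Q N)" by (simp add: P_insert mult.assoc)
    qed
    ultimately show ?thesis
      unfolding J(1) by (subst sum_Pow_insert) (use J in \<open>simp_all\<close>)
  qed
  also have "\<dots> = T i"
    by (simp add: sum_distrib_left[symmetric] sum_P_S_Q)
  finally have 1: "(\<Sum>N\<in>Pow J. P N * S (J - N) * (if i \<in> N then Q (N - {i}) else 0)) = T i" .
  have "(\<Sum>N\<in>Pow J. P N * S (J - N) * (Q N * T i)) = (\<Sum>N\<in>Pow J. P N * S (J - N) * Q N) * T i"
    by (simp add: sum_distrib_right mult.assoc)
  also have "\<dots> = T i" by (simp add: sum_P_S_Q)
  finally have "(\<Sum>N\<in>Pow J. P N * S (J - N) * (Q N * T i)) = T i" .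
  with 1 show ?thesis
    by (simp only: B_def right_diff_distrib sum_subtractf) simp
qed

lemma sum_B_S_Q:
  assumes "i \<in> J"
  shows "(\<Sum>N\<in>Pow J. adj (B i N) * S (J - N) * Q N) = 0"
  using arg_cong[OF sum_P_S_B[OF assms], of adj] by (simp add: adj_sum mult.assoc)

text \<open>The Gram matrix of the \<open>\<beta>\<^sub>i\<close>.\<close>

definition G :: "'n \<Rightarrow> 'n \<Rightarrow> 'a bop" where
  "G i j = (if i = j then 1 - Ts i * T i else T j * Ts i - Ts i * T j)"

lemma adj_G: "adj (G i j) = G j i"
  by (simp add: G_def)

text \<open>The coordinate at \<open>M\<close> of \<open>E \<beta>\<^sub>j = \<Prod>\<^sub>k\<^sub>\<noteq>\<^sub>j (I - R\<^sub>k R\<^sub>k\<^sup>*) \<beta>\<^sub>j\<close>. It is expanded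
  into a sum over \<open>K\<close> by means of \<open>R\<^sub>K\<^sup>* \<beta>\<^sub>j = \<beta>\<^sub>j T\<^sub>K\<^sup>*\<close>.\<close>

definition W :: "'n \<Rightarrow> 'n set \<Rightarrow> 'a bop" where
  "W j M = alt_sum (M - {j}) (\<lambda>K. B j (M - K) * Q K)"

text \<open>If \<open>k \<noteq> j\<close>, the summands at \<open>K\<close> and \<open>insert k K\<close> are paired, which produces the commutator in
  \<open>G k j\<close>.\<close>

lemma W_alt:
  assumes k: "k \<in> M"
  shows "W j M = alt_sum (M - {k, j}) (\<lambda>K. Q (M - {k} - K) * G k j * Q K)"
proof (cases "k = j")
  case True
  have "B j (M - K) * Q K = Q (M - {k} - K) * G k j * Q K" if "K \<subseteq> M - {k}" for K
  proof -
    have "j \<in> M - K" and eq: "M - K - {j} = M - {k} - K" using that k True by auto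
    then have "B j (M - K) = Q (M - {k} - K) - Q (M - {k} - K) * Ts j * T j"
      by (simp add: B_def Q_remove[of j "M - K"] Q_comm)
    show ?thesis unfolding \<open>B j (M - K) = _\<close> by (simp add: G_def True algebra_simps)
  qed
  then have "alt_sum (M - {k}) (\<lambda>K. B j (M - K) * Q K)
      = alt_sum (M - {k}) (\<lambda>K. Q (M - {k} - K) * G k j * Q K)"
    by (rule alt_sum_cong)
  then show ?thesis
    using True by (simp add: W_def)
next
  case False
  have "M - {j} = insert k (M - {k, j})" using k False by auto
  then have "W j M = alt_sum (M - {k, j}) (\<lambda>K. B j (M - K) * Q K - B j (M - insert k K) * Q (insert k K))"
    unfolding W_def by (simp add: alt_sum_insert)
  also have "\<dots> = alt_sum (M - {k, j}) (\<lambda>K. Q (M - {k} - K) * G k j * Q K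
      + (if j \<in> M then Q (M - K - {j}) * Q K - Q (M - insert k K - {j}) * Q (insert k K) else 0))"
  proof (rule alt_sum_cong)
    fix K assume K: "K \<subseteq> M - {k, j}"
    then have kK: "k \<notin> K" "k \<in> M - K" and j: "j \<in> M - K \<longleftrightarrow> j \<in> M" "j \<in> M - insert k K \<longleftrightarrow> j \<in> M"
      and eq: "M - insert k K = M - {k} - K" "M - K - {k} = M - {k} - K"
      using k False by auto
    have "Q (M - K) * T j * Q K = Q (M - {k} - K) * Ts k * T j * Q K"
      using Q_remove[OF kK(2)] by (simp add: eq Q_comm)
    moreover have "Q (M - {k} - K) * T j * Q (insert k K) = Q (M - {k} - K) * T j * Ts k * Q K"
      using kK by (simp add: Q_insert mult.assoc)
    ultimately have "Q (M - {k} - K) * T j * Q (insert k K) - Q (M - K) * T j * Q K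
        = Q (M - {k} - K) * G k j * Q K"
      using False by (simp add: G_def algebra_simps)
    then show "B j (M - K) * Q K - B j (M - insert k K) * Q (insert k K)
        = Q (M - {k} - K) * G k j * Q K
          + (if j \<in> M then Q (M - K - {j}) * Q K - Q (M - insert k K - {j}) * Q (insert k K) else 0)"
      by (simp only: B_def j eq(1) left_diff_distrib split: if_split)
        (use K False in \<open>auto simp: algebra_simps\<close>)
  qed
  also have "\<dots> = alt_sum (M - {k, j}) (\<lambda>K. Q (M - {k} - K) * G k j * Q K)"
  proof (rule alt_sum_cong)
    fix K assume K: "K \<subseteq> M - {k, j}"
    have "Q (M - K - {j}) * Q K = Q (M - insert k K - {j}) * Q (insert k K)" if "j \<in> M"
    proof -
      have "Q (M - K - {j}) * Q K = Q (M - {j})"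
        using K by (subst Q_union[symmetric]) (auto intro!: arg_cong[of _ _ Q])
      moreover have "Q (M - insert k K - {j}) * Q (insert k K) = Q (M - {j})"
        using K k False by (subst Q_union[symmetric]) (auto intro!: arg_cong[of _ _ Q])
      ultimately show ?thesis by simp
    qed
    then show "Q (M - {k} - K) * G k j * Q K
          + (if j \<in> M then Q (M - K - {j}) * Q K - Q (M - insert k K - {j}) * Q (insert k K) else 0)
        = Q (M - {k} - K) * G k j * Q K" by simp
  qed
  finally show ?thesis .
qed

text \<open>The range of \<open>Y\<close> lies in \<open>ker (I - T\<^sub>k\<^sup>* T\<^sub>k)\<close>, the subspace on which
  \<open>T k\<close> is isometric if it is a contraction.\<close>

definition isometric_on :: "'n \<Rightarrow> 'a bop \<Rightarrow> bool" where
  "isometric_on k Y \<longleftrightarrow> Ts k * T k * Y = Y"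

text \<open>In the dilation picture \<open>T\<^sub>k\<close> and \<open>V\<^sub>k\<close> agree on this subspace, and
  \<open>V\<^sub>j\<^sup>* V\<^sub>k = V\<^sub>k V\<^sub>j\<^sup>*\<close>. The two-variable positivity condition at the vector \<open>T\<^sub>k y\<close> is
  enough: it gives \<open>\<parallel>T\<^sub>j\<^sup>* T\<^sub>k y\<parallel> \<le> \<parallel>T\<^sub>j\<^sup>* y\<parallel>\<close>, and then
  \<open>\<parallel>T\<^sub>j\<^sup>* T\<^sub>k y - T\<^sub>k T\<^sub>j\<^sup>* y\<parallel>\<^sup>2 \<le> 0\<close> on expanding the square.\<close>

lemma isometric_on_comm:
  assumes pos: "positive_op (S {j, k})" and contr: "contraction (T k)" and "j \<noteq> k" and Y: "isometric_on k Y"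
  shows "Ts j * T k * Y = T k * Ts j * Y"
proof (rule bop_eqI)
  fix x
  define y where "y = bop_apply Y x"
  let ?t = "\<lambda>i. bop_apply (T i)" and ?s = "\<lambda>i. bop_apply (Ts i)"
  have y: "?s k (?t k y) = y"
    using Y arg_cong[of _ _ "\<lambda>Z. bop_apply Z x"] by (simp add: isometric_on_def y_def)
      (metis bop_simps(6))
  have S: "S {j, k} = 1 - T k * Ts k - T j * (1 - T k * Ts k) * Ts j"
    using \<open>j \<noteq> k\<close> by (simp add: S_insert)
  let ?n = "\<lambda>x. inner x x"
  have "0 \<le> ?n z - ?n (?s k z) - ?n (?s j z) + ?n (?s k (?s j z))" for z
  proof -
    have "0 \<le> inner (bop_apply (S {j, k}) z) z" using pos by (simp add: positive_op_iff)
    then show ?thesis by (simp add: S bop_linear_simps inner_simps adj_inner)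
  qed
  from this[of "?t k y"] have "?n (?s j (?t k y)) \<le> ?n (?s j y)"
  proof -
    have "?n (?t k y) = ?n y" by (simp add: adj_inner y)
    moreover have "?s k (?s j (?t k y)) = ?s j y"
      using comm_s[of k j] y by (metis bop_simps(6))
    ultimately show ?thesis
      using \<open>0 \<le> ?n (?t k y) - _ - _ + _\<close> by (simp add: y)
  qed
  moreover have "?n (?t k (?s j y)) \<le> ?n (?s j y)"
    using contr by (simp add: contraction_def norm_le)
  moreover have "inner (?s j (?t k y)) (?t k (?s j y)) = ?n (?s j y)"
    using comm_s[of k j] y by (metis adj_inner' bop_simps(6))
  ultimately have "?n (?s j (?t k y) - ?t k (?s j y)) \<le> 0"
    by (simp add: inner_simps inner_commute)
  then have "?s j (?t k y) = ?t k (?s j y)"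
    by (metis inner_ge_zero inner_eq_zero_iff order_antisym right_minus_eq)
  then show "bop_apply (Ts j * T k * Y) x = bop_apply (T k * Ts j * Y) x"
    by (simp add: y_def)
qed

end

section \<open>The Beurling condition\<close>

text \<open>The consequences of the Beurling condition on which the identity \<open>D_eq_sum\<close> rests. The operators in
  \<open>defect_orth\<close> are the squares of the defect operators.\<close>

locale beurling_relations = commuting_tuple T
  for T :: "'n::{finite,linorder} \<Rightarrow> 'a::chilbert_space bop" +
  assumes contr: "contraction (T i)"
    and S_pos: "positive_op (S L)"
    and defect_orth: "i \<noteq> j \<Longrightarrow> (1 - Ts i * T i) * (1 - Ts j * T j) = 0"
begin

lemma isometric_on_iff: "isometric_on k Y \<longleftrightarrow> (1 - Ts k * T k) * Y = 0"
  by (auto simp: isometric_on_def left_diff_distrib)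

lemma isometric_on_Ts:
  assumes "j \<noteq> k" "isometric_on k Y"
  shows "isometric_on k (Ts j * Y)"
proof -
  have "Ts k * (T k * (Ts j * Y)) = Ts k * (Ts j * (T k * Y))"
    using isometric_on_comm[OF S_pos contr assms] by (simp add: mult.assoc)
  also have "\<dots> = Ts j * (Ts k * T k * Y)"
    by (simp only: mult.assoc[symmetric] comm_s[of k j])
  also have "\<dots> = Ts j * Y"
    using assms by (simp add: isometric_on_def)
  finally show ?thesis by (simp add: isometric_on_def mult.assoc)
qed

lemma isometric_on_Q:
  assumes Y: "isometric_on k Y"
  shows "k \<notin> K \<Longrightarrow> isometric_on k (Q K * Y) \<and> Q K * T k * Y = T k * Q K * Y"
proof (induction K rule: finite_induct[OF finite])
  case (2 j K)
  then have IH: "isometric_on k (Q K * Y)" "Q K * T k * Y = T k * Q K * Y" and "j \<noteq> k" by auto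
  have "Ts j * (Q K * T k * Y) = T k * (Ts j * (Q K * Y))"
    using isometric_on_comm[OF S_pos contr \<open>j \<noteq> k\<close> IH(1)] unfolding IH(2) by (simp only: mult.assoc)
  then show ?case
    using isometric_on_Ts[OF \<open>j \<noteq> k\<close> IH(1)] 2 by (simp add: Q_insert mult.assoc)
qed (simp add: Y)

lemma G_isometric_on:
  assumes "isometric_on k Y"
  shows "G j k * Y = 0"
proof (cases "j = k")
  case True
  then show ?thesis using assms by (simp add: G_def isometric_on_iff)
next
  case False
  then show ?thesis
    using isometric_on_comm[OF S_pos contr False assms] by (simp add: G_def left_diff_distrib)
qed

text \<open>The range of \<open>G k j\<close>, being that of \<open>\<beta>\<^sub>k\<^sup>* \<beta>\<^sub>j\<close>, lies in \<open>ker \<beta>\<^sub>l = ker (I - T\<^sub>l\<^sup>* T\<^sub>l)\<close>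
  for \<open>l \<noteq> k\<close>, even after multiplication by \<open>T\<^sub>K\<close> with \<open>k \<notin> K\<close>. The adjoint relation is the one
  that is proved.\<close>

lemma isometric_on_P_G:
  assumes "l \<noteq> k" "k \<notin> K"
  shows "isometric_on l (P K * G k j)"
proof -
  have "isometric_on k (1 - Ts l * T l)"
    using defect_orth[of k l] assms by (simp add: isometric_on_iff)
  then have "isometric_on k (Q K * (1 - Ts l * T l))"
    using isometric_on_Q assms by blast
  then have "G j k * (Q K * (1 - Ts l * T l)) = 0"
    by (rule G_isometric_on)
  from arg_cong[OF this, of adj] show ?thesis
    by (simp add: isometric_on_iff adj_G mult.assoc)
qed

text \<open>The counterpart of \<open>(I - V\<^sub>l V\<^sub>l\<^sup>*) V\<^sub>l = 0\<close>.\<close>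

lemma S_T_isometric_on:
  assumes Y: "isometric_on l Y" and "l \<in> L"
  shows "S L * T l * Y = 0"
proof -
  obtain L' where L: "L = insert l L'" "l \<notin> L'"
    using assms by (meson mk_disjoint_insert)
  have "P K * Q K * T l * Y = T l * (P K * Q K * Y)" if "K \<subseteq> L'" for K
  proof -
    have "l \<notin> K" using that L by auto
    then have "P K * (Q K * T l * Y) = P K * T l * (Q K * Y)"
      using isometric_on_Q[OF Y] by (simp add: mult.assoc)
    then show ?thesis by (simp only: P_comm[symmetric] mult.assoc)
  qed
  then have *: "S L' * T l * Y = T l * (S L' * Y)"
    unfolding S_def alt_sum_mult_right alt_sum_mult_left by (rule alt_sum_cong)
  have "S L * T l * Y = S L' * T l * Y - T l * S L' * (Ts l * T l * Y)"
    by (simp add: L S_insert left_diff_distrib mult.assoc)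
  also have "\<dots> = 0"
    using Y * by (simp add: isometric_on_def mult.assoc)
  finally show ?thesis .
qed

lemma Q_P_G:
  assumes "k \<notin> M"
  shows "K \<subseteq> M \<Longrightarrow> Q M * P K * G k j = Q (M - K) * G k j"
  using assms
proof (induction K arbitrary: M rule: finite_induct[OF finite])
  case (2 l K)
  then have l: "l \<in> M" "l \<noteq> k" "k \<notin> K" "l \<notin> K" by auto
  have "Q M = Q (M - {l}) * Ts l"
    using Q_remove[OF l(1)] by (simp add: Q_comm)
  then have "Q M * P (insert l K) * G k j = Q (M - {l}) * (Ts l * T l * (P K * G k j))"
    using l by (simp add: P_insert mult.assoc)
  also have "\<dots> = Q (M - {l}) * P K * G k j"
    using isometric_on_P_G[OF l(2,3), of j] by (simp add: isometric_on_def mult.assoc)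
  also have "\<dots> = Q (M - {l} - K) * G k j"
    using 2 by (intro 2) auto
  also have "M - {l} - K = M - insert l K" by auto
  finally show ?case .
qed simp

text \<open>The entry of the operator matrix, uniformly in the diagonal and off-diagonal cases.\<close>

definition D :: "'n \<Rightarrow> 'n \<Rightarrow> 'a bop" where
  "D i j = Delta_alt (UNIV - {i, j}) (G i j)"

text \<open>The coordinate form of \<open>V\<^sub>k\<^sup>* E \<beta>\<^sub>j = D k j\<close>: the form \<open>S (- M)\<close> does not distinguish \<open>W j M\<close>
  from \<open>T\<^sub>N\<^sup>* D k j\<close>, \<open>N = M - {k}\<close>. The two differ by terms starting with some \<open>T l\<close>, \<open>l \<notin> M\<close>, which
  the factor \<open>S (- M)\<close> annihilates.\<close>

lemma S_W:
  assumes k: "k \<in> M"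
  shows "S (- M) * W j M = S (- M) * Q (M - {k}) * D k j"
proof -
  have "S (- M) * Q (M - {k}) * D k j
      = alt_sum (UNIV - {k, j}) (\<lambda>K. S (- M) * (Q (M - {k}) * P K * G k j) * Q K)"
    by (simp add: D_def Delta_alt_def alt_sum_mult_left mult.assoc)
  also have "\<dots> = alt_sum (M - {k, j}) (\<lambda>K. S (- M) * (Q (M - {k}) * P K * G k j) * Q K)"
  proof (rule alt_sum_restrict)
    fix K assume K: "K \<subseteq> UNIV - {k, j}" "\<not> K \<subseteq> M - {k, j}"
    then obtain l where l: "l \<in> K" "l \<notin> M" by blast
    define Y where "Y = P (K - {l}) * G k j"
    have "l \<noteq> k" using k l by auto
    then have Y: "isometric_on l Y"
      using K unfolding Y_def by (intro isometric_on_P_G) auto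
    have "P K * G k j = T l * Y"
      using P_insert[of l "K - {l}"] l by (simp add: Y_def insert_absorb mult.assoc)
    moreover have Q: "isometric_on l (Q (M - {k}) * Y)"
      "Q (M - {k}) * T l * Y = T l * Q (M - {k}) * Y"
      using isometric_on_Q[OF Y, of "M - {k}"] l by auto
    ultimately have "S (- M) * (Q (M - {k}) * P K * G k j) = S (- M) * T l * (Q (M - {k}) * Y)"
      by (simp add: mult.assoc)
    also have "\<dots> = 0"
      using Q l by (intro S_T_isometric_on) auto
    finally show "S (- M) * (Q (M - {k}) * P K * G k j) * Q K = 0" by simp
  qed auto
  also have "\<dots> = alt_sum (M - {k, j}) (\<lambda>K. S (- M) * (Q (M - {k} - K) * G k j * Q K))"
  proof (rule alt_sum_cong)
    fix K assume "K \<subseteq> M - {k, j}"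
    then have "Q (M - {k}) * P K * G k j = Q (M - {k} - K) * G k j"
      by (intro Q_P_G) auto
    then show "S (- M) * (Q (M - {k}) * P K * G k j) * Q K = S (- M) * (Q (M - {k} - K) * G k j * Q K)"
      by (simp only: mult.assoc)
  qed
  also have "\<dots> = S (- M) * W j M"
    by (simp add: W_alt[OF k] alt_sum_mult_left)
  finally show ?thesis by simp
qed

lemma sum_alt_sum_swap:
  "(\<Sum>M\<in>UNIV. alt_sum (M - {j}) (\<lambda>K. f K M))
    = alt_sum (UNIV - {j}) (\<lambda>K. \<Sum>N\<in>Pow (- K). f K (K \<union> N))"
  for f :: "'n set \<Rightarrow> 'n set \<Rightarrow> 'b::real_vector"
proof -
  let ?g = "\<lambda>K M. (- 1) ^ card K *\<^sub>R f K M"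
  have "(\<Sum>M\<in>UNIV. alt_sum (M - {j}) (\<lambda>K. f K M))
      = (\<Sum>M\<in>UNIV. \<Sum>K | K \<in> Pow (UNIV - {j}) \<and> K \<subseteq> M. ?g K M)"
    unfolding alt_sum_def by (intro sum.cong) auto
  also have "\<dots> = (\<Sum>K\<in>Pow (UNIV - {j}). \<Sum>M | M \<in> UNIV \<and> K \<subseteq> M. ?g K M)"
    by (rule sum.swap_restrict) auto
  also have "\<dots> = (\<Sum>K\<in>Pow (UNIV - {j}). \<Sum>N\<in>Pow (- K). ?g K (K \<union> N))"
  proof (rule sum.cong[OF refl])
    fix K
    show "(\<Sum>M | M \<in> UNIV \<and> K \<subseteq> M. ?g K M) = (\<Sum>N\<in>Pow (- K). ?g K (K \<union> N))"
      by (rule sum.reindex_bij_witness[of _ "\<lambda>N. K \<union> N" "\<lambda>M. M - K"])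
        (auto simp: Un_absorb1)
  qed
  finally show ?thesis
    by (simp add: alt_sum_def scaleR_sum_right)
qed

text \<open>The range of \<open>E \<beta>\<^sub>j\<close> is orthogonal to \<open>\<H>\<close>.\<close>

lemma sum_P_S_W: "(\<Sum>M\<in>UNIV. P M * S (- M) * W j M) = 0"
proof -
  have "(\<Sum>M\<in>UNIV. P M * S (- M) * W j M)
      = (\<Sum>M\<in>UNIV. alt_sum (M - {j}) (\<lambda>K. P M * S (- M) * (B j (M - K) * Q K)))"
    by (simp add: W_def alt_sum_mult_left)
  also have "\<dots> = alt_sum (UNIV - {j})
      (\<lambda>K. \<Sum>N\<in>Pow (- K). P (K \<union> N) * S (- (K \<union> N)) * (B j (K \<union> N - K) * Q K))"
    by (rule sum_alt_sum_swap)
  also have "\<dots> = 0"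
  proof (rule alt_sum_zero)
    fix K assume K: "K \<subseteq> UNIV - {j}"
    have "(\<Sum>N\<in>Pow (- K). P (K \<union> N) * S (- (K \<union> N)) * (B j (K \<union> N - K) * Q K))
        = (\<Sum>N\<in>Pow (- K). P K * (P N * S (- K - N) * B j N) * Q K)"
    proof (rule sum.cong[OF refl])
      fix N assume "N \<in> Pow (- K)"
      then have "K \<inter> N = {}" "- (K \<union> N) = - K - N" "K \<union> N - K = N" by auto
      then show "P (K \<union> N) * S (- (K \<union> N)) * (B j (K \<union> N - K) * Q K)
          = P K * (P N * S (- K - N) * B j N) * Q K"
        by (simp only: P_union mult.assoc)
    qed
    also have "\<dots> = P K * (\<Sum>N\<in>Pow (- K). P N * S (- K - N) * B j N) * Q K"
      by (simp only: sum_distrib_left sum_distrib_right)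
    also have "\<dots> = 0"
    proof -
      have "j \<in> - K" using K by auto
      then show ?thesis by (simp add: sum_P_S_B)
    qed
    finally show "(\<Sum>N\<in>Pow (- K). P (K \<union> N) * S (- (K \<union> N)) * (B j (K \<union> N - K) * Q K)) = 0" .
  qed
  finally show ?thesis .
qed

text \<open>In the expansion of \<open>W i M\<close> over \<open>K\<close>, the term of \<open>K = {}\<close> contributes
  \<open>\<beta>\<^sub>i\<^sup>* E \<beta>\<^sub>j = D i j\<close>. A term with \<open>k \<in> K\<close> contributes nothing, as
  \<open>V\<^sub>k\<^sup>* E \<beta>\<^sub>j\<close> has its range in \<open>\<H>\<close>, to which the range of \<open>\<beta>\<^sub>i\<close> is orthogonal.\<close>

theorem D_eq_sum: "D i j = (\<Sum>M\<in>UNIV. adj (W i M) * S (- M) * W j M)"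
proof -
  let ?f = "\<lambda>K M. P K * adj (B i (M - K)) * S (- M) * W j M"
  have "(\<Sum>M\<in>UNIV. adj (W i M) * S (- M) * W j M) = (\<Sum>M\<in>UNIV. alt_sum (M - {i}) (\<lambda>K. ?f K M))"
    by (simp add: W_def[of i] alt_sum_adj alt_sum_mult_right)
  also have "\<dots> = alt_sum (UNIV - {i}) (\<lambda>K. \<Sum>N\<in>Pow (- K). ?f K (K \<union> N))"
    by (rule sum_alt_sum_swap)
  also have "\<dots> = alt_sum {} (\<lambda>K. \<Sum>N\<in>Pow (- K). ?f K (K \<union> N))"
  proof (rule alt_sum_restrict)
    fix K assume K: "K \<subseteq> UNIV - {i}" "\<not> K \<subseteq> {}"
    then obtain k where k: "k \<in> K" by auto
    have "(\<Sum>N\<in>Pow (- K). ?f K (K \<union> N))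
        = (\<Sum>N\<in>Pow (- K). P K * (adj (B i N) * S (- K - N) * Q N) * (Q (K - {k}) * D k j))"
    proof (rule sum.cong[OF refl])
      fix N assume "N \<in> Pow (- K)"
      then have *: "N \<inter> (K - {k}) = {}" "- (K \<union> N) = - K - N" "K \<union> N - K = N"
        "K \<union> N - {k} = N \<union> (K - {k})" using k by auto
      have "S (- (K \<union> N)) * W j (K \<union> N) = S (- K - N) * (Q N * Q (K - {k})) * D k j"
        using S_W[of k "K \<union> N" j] k by (simp only: * Q_union UnI1)
      then show "?f K (K \<union> N) = P K * (adj (B i N) * S (- K - N) * Q N) * (Q (K - {k}) * D k j)"
        by (simp only: * mult.assoc)
    qed
    also have "\<dots> = P K * (\<Sum>N\<in>Pow (- K). adj (B i N) * S (- K - N) * Q N) * (Q (K - {k}) * D k j)"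
      by (simp only: sum_distrib_left sum_distrib_right)
    also have "\<dots> = 0"
    proof -
      have "i \<in> - K" using K by auto
      then show ?thesis by (simp add: sum_B_S_Q)
    qed
    finally show "(\<Sum>N\<in>Pow (- K). ?f K (K \<union> N)) = 0" .
  qed auto
  also have "\<dots> = (\<Sum>M\<in>UNIV. adj (B i M) * S (- M) * W j M)"
    by simp
  also have "\<dots> = (\<Sum>M\<in>UNIV. (if i \<in> M then P (M - {i}) else 0) * S (- M) * W j M)
      - Ts i * (\<Sum>M\<in>UNIV. P M * S (- M) * W j M)"
  proof -
    have "adj (B i M) = (if i \<in> M then P (M - {i}) else 0) - Ts i * P M" for M
      by (simp add: B_def)
    then show ?thesis
      by (simp only: left_diff_distrib sum_subtractf sum_distrib_left mult.assoc)
  qed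
  also have "\<dots> = (\<Sum>M\<in>Pow (insert i (UNIV - {i})). (if i \<in> M then P (M - {i}) else 0) * S (- M) * W j M)"
    by (simp add: sum_P_S_W insert_absorb)
  also have "\<dots> = (\<Sum>N\<in>Pow (UNIV - {i}). P N * S (UNIV - {i} - N) * Q N * D i j)"
  proof -
    have "(\<Sum>M\<in>Pow (UNIV - {i}). (if i \<in> M then P (M - {i}) else 0) * S (- M) * W j M) = 0"
      by (intro sum.neutral) auto
    moreover have "(\<Sum>N\<in>Pow (UNIV - {i}). (if i \<in> insert i N then P (insert i N - {i}) else 0)
          * S (- insert i N) * W j (insert i N))
        = (\<Sum>N\<in>Pow (UNIV - {i}). P N * S (UNIV - {i} - N) * Q N * D i j)"
    proof (rule sum.cong[OF refl])
      fix N assume "N \<in> Pow (UNIV - {i})"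
      then have *: "insert i N - {i} = N" "- insert i N = UNIV - {i} - N" by auto
      have "S (- insert i N) * W j (insert i N) = S (UNIV - {i} - N) * Q N * D i j"
        using S_W[of i "insert i N" j] by (simp only: * insertI1)
      then show "(if i \<in> insert i N then P (insert i N - {i}) else 0)
          * S (- insert i N) * W j (insert i N) = P N * S (UNIV - {i} - N) * Q N * D i j"
        by (simp add: * mult.assoc)
    qed
    ultimately show ?thesis
      by (subst sum_Pow_insert) simp_all
  qed
  also have "\<dots> = D i j"
    by (simp only: sum_distrib_right[symmetric] sum_P_S_Q mult_1_left)
  finally show ?thesis ..
qed

lemma positive_op_matrix_D: "positive_op (op_matrix D)"
  unfolding positive_op_def
proof
  fix x :: "('a, 'n) vec"
  define g where "g M = (\<Sum>j\<in>UNIV. bop_apply (W j M) (x $ j))" for M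
  have "cinner (bop_apply (op_matrix D) x) x
      = (\<Sum>i\<in>UNIV. \<Sum>j\<in>UNIV. cinner (bop_apply (D i j) (x $ j)) (x $ i))"
    by (simp add: cinner_vec_def op_matrix.rep_eq cinner_sum_left)
  also have "\<dots> = (\<Sum>i\<in>UNIV. \<Sum>j\<in>UNIV. \<Sum>M\<in>UNIV.
      cinner (bop_apply (S (- M)) (bop_apply (W j M) (x $ j))) (bop_apply (W i M) (x $ i)))"
    by (simp add: D_eq_sum bop_sum cinner_sum_left adj_cinner)
  also have "\<dots> = (\<Sum>i\<in>UNIV. \<Sum>M\<in>UNIV. \<Sum>j\<in>UNIV.
      cinner (bop_apply (S (- M)) (bop_apply (W j M) (x $ j))) (bop_apply (W i M) (x $ i)))"
    by (rule sum.cong[OF refl], rule sum.swap)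
  also have "\<dots> = (\<Sum>M\<in>UNIV. \<Sum>i\<in>UNIV. \<Sum>j\<in>UNIV.
      cinner (bop_apply (S (- M)) (bop_apply (W j M) (x $ j))) (bop_apply (W i M) (x $ i)))"
    by (rule sum.swap)
  also have "\<dots> = (\<Sum>M\<in>UNIV. cinner (bop_apply (S (- M)) (g M)) (g M))"
    unfolding g_def bop_linear_simps cinner_sum_right unfolding cinner_sum_left ..
  also have "\<dots> \<in> \<real>\<^sub>\<ge>\<^sub>0"
    using S_pos by (auto simp: positive_op_def complex_nonneg_Reals_iff intro!: sum_nonneg)
  finally show "cinner (bop_apply (op_matrix D) x) x \<in> \<real>\<^sub>\<ge>\<^sub>0" .
qed

end

section \<open>Positivity of the partial Szego operators\<close>

context commuting_tuple
begin

lemma prod_list_eq_P: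
  assumes "distinct ks" "\<And>i. k i \<in> {0, 1}"
  shows "(\<Prod>i\<leftarrow>ks. T i ^ k i) = P {i \<in> set ks. k i = 1}"
    "(\<Prod>i\<leftarrow>ks. Ts i ^ k i) = Q {i \<in> set ks. k i = 1}"
  using assms(1)
proof (induction ks)
  case (Cons l ks)
  have *: "{i \<in> set (l # ks). k i = 1}
      = (if k l = 1 then insert l {i \<in> set ks. k i = 1} else {i \<in> set ks. k i = 1})" by auto
  {
    case 1
    show ?case using Cons 1 assms(2)[of l] unfolding * by (auto simp: P_insert)
  next
    case 2
    show ?case using Cons 2 assms(2)[of l] unfolding * by (auto simp: Q_insert)
  }
qed simp_all

lemma szego_inverse_eq: "szego_inverse T = S UNIV"
proof -
  have "szego_inverse T = (\<Sum>K\<in>UNIV. (- 1) ^ card K *\<^sub>R (P K * Q K))"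
    unfolding szego_inverse_def
  proof (rule sum.reindex_bij_witness[of _ "\<lambda>K i. of_bool (i \<in> K)" "\<lambda>k. {i. k i = 1}"])
    fix k :: "'n \<Rightarrow> nat" assume "k \<in> {k. \<forall>i. k i \<in> {0, 1}}"
    then have k: "\<And>i. k i \<in> {0, 1}" by auto
    then have k': "k i = of_bool (k i = 1)" for i by (metis insertE of_bool_eq singletonD)
    then show "(\<lambda>i. of_bool (i \<in> {i. k i = 1})) = k" by auto
    have "(\<Sum>i\<in>UNIV. k i) = (\<Sum>i\<in>UNIV. if k i = 1 then 1 else 0)"
      by (intro sum.cong refl) (metis k' of_bool_def)
    then have "(\<Sum>i\<in>UNIV. k i) = card {i. k i = 1}"
      by (simp add: sum.If_cases)
    then show "(- 1) ^ card {i. k i = 1} *\<^sub>R (P {i. k i = 1} * Q {i. k i = 1})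
        = (- 1) ^ (\<Sum>i\<in>UNIV. k i) *\<^sub>R (multi_power T k * multi_power (\<lambda>i. Ts i) k)"
      by (simp add: multi_power_def prod_list_eq_P[OF distinct_sorted_list_of_set k])
  qed auto
  then show ?thesis by (simp add: S_def alt_sum_def)
qed

text \<open>By hypothesis \<open>S L \<ge> T\<^sub>i (S L) T\<^sub>i\<^sup>*\<close>. Iterating, \<open>S L \<ge> T\<^sub>i\<^sup>m (S L) T\<^sub>i\<^sup>*\<^sup>m\<close>, and the
  right-hand side tends to \<open>0\<close> weakly.\<close>

lemma positive_S_remove:
  assumes pos: "positive_op (S (insert i L))" and "i \<notin> L" and C0: "C_dot_zero (T i)"
  shows "positive_op (S L)"
proof -
  let ?q = "\<lambda>x. inner (bop_apply (S L) x) x"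
  have step: "?q (bop_apply (Ts i) x) \<le> ?q x" for x
  proof -
    have "0 \<le> inner (bop_apply (S (insert i L)) x) x"
      using pos by (simp add: positive_op_iff)
    then show ?thesis
      using \<open>i \<notin> L\<close> by (simp add: S_insert inner_diff_left adj_inner)
  qed
  have iter: "?q (bop_apply (Ts i ^ m) x) \<le> ?q x" for m x
  proof (induction m)
    case (Suc m)
    then show ?case using step[of "bop_apply (Ts i ^ m) x"] by simp
  qed simp
  have "0 \<le> ?q x" for x
  proof (rule LIMSEQ_le_const2)
    have "(\<lambda>m. ?q (bop_apply (Ts i ^ m) x)) \<longlonglongrightarrow> inner (bop_apply (S L) 0) 0"
      using C0 unfolding C_dot_zero_def
      by (intro tendsto_intros bounded_linear.tendsto[OF bop_linear]) auto
    then show "(\<lambda>m. ?q (bop_apply (Ts i ^ m) x)) \<longlonglongrightarrow> 0" by simp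
    show "\<exists>N. \<forall>n\<ge>N. ?q (bop_apply (Ts i ^ n) x) \<le> ?q x" using iter by blast
  qed
  then show ?thesis by (simp add: positive_op_iff)
qed

lemma positive_S:
  assumes "positive_op (S UNIV)" "\<And>i. C_dot_zero (T i)"
  shows "positive_op (S L)"
proof -
  have "positive_op (S (- K))" for K
  proof (induction K rule: finite_induct[OF finite])
    case (2 i K)
    then have "- K = insert i (- insert i K)" by auto
    with 2 have "positive_op (S (insert i (- insert i K)))" by simp
    then show ?case
      by (rule positive_S_remove) (simp_all add: assms)
  qed (simp add: assms)
  from this[of "- L"] show ?thesis by simp
qed

end

section \<open>The operator matrix of a Beurling tuple\<close>

lemma beurling_tuple_relations:
  assumes "beurling_tuple T"
  shows "beurling_relations T"
proof -
  have sz: "\<And>i. contraction (T i)" "\<And>i j. T i * T j = T j * T i"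
    "positive_op (szego_inverse T)" "\<And>i. C_dot_zero (T i)"
    and orth: "\<And>i j. i \<noteq> j \<Longrightarrow> defect (T i) * defect (T j) = 0"
    using assms by (auto simp: beurling_tuple_def szego_tuple_def)
  interpret commuting_tuple T by standard (rule sz)
  show ?thesis
  proof
    show "contraction (T i)" for i by (rule sz)
    show "positive_op (S L)" for L
      by (rule positive_S) (use sz in \<open>simp_all add: szego_inverse_eq\<close>)
    show "(1 - Ts i * T i) * (1 - Ts j * T j) = 0" if "i \<noteq> j" for i j
    proof -
      have "(1 - Ts i * T i) * (1 - Ts j * T j)
          = defect (T i) * (defect (T i) * defect (T j)) * defect (T j)"
        by (simp only: defect_square[OF sz(1), symmetric] mult.assoc)
      then show ?thesis using orth[OF that] by simp
    qed
  qed
qed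

theorem proposition6p2:
  fixes T :: "'n::{finite,linorder} \<Rightarrow> 'a::{chilbert_space,second_countable_topology} bop"
  assumes "beurling_tuple T"
  shows "positive_op (defect_matrix T)"
proof -
  interpret beurling_relations T
    using assms by (rule beurling_tuple_relations)
  have "(if i = j then defect_sq T j else delta_entry T i j) = D i j" for i j
    by (simp add: D_def G_def defect_sq_def delta_entry_def commutator_def Delta_prod_eq
        power2_eq_square defect_square[OF contr])
  then have "defect_matrix T = op_matrix D"
    by (simp add: defect_matrix_def fun_eq_iff)
  then show ?thesis using positive_op_matrix_D by simp
qed

end
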